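(* Let $x\in|\mathbb{P}^1|$ be a closed point of degree one and let $K'=K_x'\times\prod_{y\neq x}K_y$ with $K_x'=\{k\in K_x\mid k\equiv \mathrm{id} \bmod (\pi_x)\}$. Then there are no nontrivial ramified (with respect to $K'$) cuspidal automorphic forms for the projective line, i.e. $\mathcal{A}_0^{K'}=\{0\}$.
   Context: Let $q$ be a prime power and $F=\mathbb{F}_q(t)$ the function field of $\mathbb{P}^1$ over $\mathbb{F}_q$; $|\mathbb{P}^1|$ is the set of closed points (equivalently, places of $F$). For $y\in|\mathbb{P}^1|$: $F_y$ is the completion of $F$ at $y$, $\mathcal{O}_y$ its ring of integers, $\pi_y\in F$ a uniformizer, $\kappa(y)=\mathcal{O}_y/(\pi_y)$, the degree of $y$ is $|y|=[\kappa(y):\mathbb{F}_q]$, and $|\cdot|_y$ is the absolute value with $|\pi_y|_y=q^{-|y|}$. $\mathbb{A}$ is the adele ring of $F$, $G=\mathrm{GL}_2$, $Z$ is the center of $G(\mathbb{A})$, $K_y=\mathrm{GL}_2(\mathcal{O}_y)$. $\mathcal{A}^{K'}$ is the complex vector space of functions $f:G(\mathbb{A})\to\mathbb{C}$ that are left $G(F)$-invariant, $Z$-invariant, right $K'$-invariant, and of moderate growth, i.e. there are constants $C,N$ with $|f(g)|\le C|g|^N$ for all $g\in G(\mathbb{A})$. Here $|g|=\prod_y |g_y|_y$, with $|g_y|_y$ the maximum of the $y$-adic absolute values of the entries of $g_y$ and of $\det(g_y)^{-1}$. An element $f\in\mathcal{A}^{K'}$ is a cusp form if $\int_{U(F)\backslash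 U(\mathbb{A})}f(ug)\,du=0$ for all $g\in G(\mathbb{A})$ and for the unipotent radical $U$ of every proper standard parabolic subgroup of $G$; for $G=\mathrm{GL}_2$ this means $U=\left\{\begin{pmatrix}1&*\\0&1\end{pmatrix}\right\}$. $\mathcal{A}_0^{K'}$ is the space of cusp forms in $\mathcal{A}^{K'}$. *)

theory Defs
  imports
    "HOL-Analysis.Analysis"
    "HOL-Library.Groups_Big_Fun"
    "HOL-Computational_Algebra.Polynomial"
    "HOL-Computational_Algebra.Fraction_Field"
    "HOL-Algebra.Embedded_Algebras"
    "HOL-Algebra.QuotRing"
begin

section \<open>The function field and its places\<close>

text \<open>
  The finite field \<open>\<bbbF>\<^sub>q\<close> is an arbitrary type \<open>'a\<close> of class \<open>{field, finite}\<close>, with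
  \<open>q = CARD('a)\<close>, and \<open>F = \<bbbF>\<^sub>q(t)\<close> is the fraction field of its polynomial ring.
\<close>

type_synonym 'a ratfun = "'a poly fract"

definition poly_to_ratfun :: "'a::field poly \<Rightarrow> 'a ratfun" where
  "poly_to_ratfun p = Fract p 1"

text \<open>
  A place is a normalised discrete valuation of \<open>F\<close>. The value \<open>v 0 = 0\<close> is only a dummy
  (the true value is \<open>\<infinity>\<close>); every use below treats \<open>0\<close> separately. Triviality on \<open>\<bbbF>\<^sub>q\<close> is
  automatic, since the nonzero constants are roots of unity.
\<close>

definition normalised_valuation :: "('a::field ratfun \<Rightarrow> int) \<Rightarrow> bool" where
  "normalised_valuation v \<longleftrightarrow>
     v 0 = 0 \<and>
     (\<exists>f. f \<noteq> 0 \<and> v f = 1) \<and>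
     (\<forall>f g. f \<noteq> 0 \<longrightarrow> g \<noteq> 0 \<longrightarrow> v (f * g) = v f + v g) \<and>
     (\<forall>f g. f \<noteq> 0 \<longrightarrow> g \<noteq> 0 \<longrightarrow> f + g \<noteq> 0 \<longrightarrow> min (v f) (v g) \<le> v (f + g))"

definition infinity_val :: "'a::field ratfun \<Rightarrow> int" where
  "infinity_val f = (THE n. \<exists>a b. b \<noteq> 0 \<and> f = Fract a b \<and>
     n = (if a = 0 then 0 else int (degree b) - int (degree a)))"

lemma infinity_val_Fract:
  assumes "b \<noteq> 0"
  shows "infinity_val (Fract a b) = (if a = 0 then 0 else int (degree b) - int (degree a))"
  unfolding infinity_val_def
proof (rule the_equality)
  show "\<exists>a' b'. b' \<noteq> 0 \<and> Fract a b = Fract a' b' \<and>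
    (if a = 0 then 0 else int (degree b) - int (degree a)) =
    (if a' = 0 then 0 else int (degree b') - int (degree a'))"
    using assms by blast
next
  fix n
  assume "\<exists>c d. d \<noteq> 0 \<and> Fract a b = Fract c d \<and> n = (if c = 0 then 0 else int (degree d) - int (degree c))"
  then obtain c d where nz: "d \<noteq> 0" and eq: "a * d = c * b"
    and n: "n = (if c = 0 then 0 else int (degree d) - int (degree c))"
    using assms eq_fract(1)[of b] by blast
  show "n = (if a = 0 then 0 else int (degree b) - int (degree a))"
  proof (cases "a = 0")
    case True
    with assms nz eq show ?thesis by (simp add: n)
  next
    case False
    with nz eq have "c \<noteq> 0" by auto
    from False nz have "degree (a * d) = degree a + degree d" by (simp add: degree_mult_eq)
    moreover from \<open>c \<noteq> 0\<close> assms have "degree (c * b) = degree c + degree b" by (simp add: degree_mult_eq)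
    ultimately show ?thesis using False \<open>c \<noteq> 0\<close> eq by (simp add: n)
  qed
qed

lemma normalised_valuation_infinity_val: "normalised_valuation (infinity_val :: 'a::field ratfun \<Rightarrow> int)"
  unfolding normalised_valuation_def
proof (intro conjI allI impI)
  show "infinity_val (0 :: 'a ratfun) = 0"
    by (simp add: Zero_fract_def infinity_val_Fract)
  show "\<exists>f :: 'a ratfun. f \<noteq> 0 \<and> infinity_val f = 1"
    by (rule exI[of _ "Fract 1 [:0, 1:]"]) (simp add: infinity_val_Fract Zero_fract_def eq_fract)
next
  fix f g :: "'a ratfun"
  assume nz: "f \<noteq> 0" "g \<noteq> 0"
  obtain a b where f: "f = Fract a b" "b \<noteq> 0" by (cases f)
  obtain c d where g: "g = Fract c d" "d \<noteq> 0" by (cases g)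
  from nz f g have ac: "a \<noteq> 0" "c \<noteq> 0" by (auto simp: Zero_fract_def eq_fract)
  show "infinity_val (f * g) = infinity_val f + infinity_val g"
    using f g ac by (simp add: infinity_val_Fract degree_mult_eq)
  assume s: "f + g \<noteq> 0"
  have fg: "f + g = Fract (a * d + c * b) (b * d)" using f g by simp
  from s fg have n0: "a * d + c * b \<noteq> 0" by (auto simp: Zero_fract_def eq_fract)
  have "degree (a * d + c * b) \<le> max (degree (a * d)) (degree (c * b))" by (rule degree_add_le_max)
  then show "min (infinity_val f) (infinity_val g) \<le> infinity_val (f + g)"
    unfolding fg using n0 f g ac
    by (simp add: infinity_val_Fract degree_mult_eq)
qed

typedef (overloaded) 'a place = "{v :: 'a::{field, finite} ratfun \<Rightarrow> int. normalised_valuation v}"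
  morphisms place_val Place
  using normalised_valuation_infinity_val by blast

text \<open>
  The residue field is taken as that of the local ring in \<open>F\<close>; it is canonically the residue
  field \<open>\<kappa>(y)\<close> of the completion. The degree is its dimension over the image of the constants.
\<close>

definition local_ring :: "'a::{field, finite} place \<Rightarrow> 'a ratfun ring" where
  "local_ring y =
     \<lparr>carrier = {f. f = 0 \<or> place_val y f \<ge> 0}, monoid.mult = (*), one = 1, zero = 0, add = (+)\<rparr>"

definition local_max_ideal :: "'a::{field, finite} place \<Rightarrow> 'a ratfun set" where
  "local_max_ideal y = {f. f = 0 \<or> place_val y f > 0}"

definition residue_field :: "'a::{field, finite} place \<Rightarrow> 'a ratfun set ring" where
  "residue_field y = local_ring y Quot local_max_ideal y"

definition residue_constants :: "'a::{field, finite} place \<Rightarrow> 'a ratfun set set" where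
  "residue_constants y = range (\<lambda>c. local_max_ideal y +>\<^bsub>local_ring y\<^esub> poly_to_ratfun [:c:])"

definition place_degree :: "'a::{field, finite} place \<Rightarrow> nat" where
  "place_degree y = ring.dim (residue_field y) (residue_constants y) (carrier (residue_field y))"

definition place_abs :: "'a::{field, finite} place \<Rightarrow> 'a ratfun \<Rightarrow> real" where
  "place_abs y f =
     (if f = 0 then 0 else real CARD('a) powr (- real (place_degree y) * real_of_int (place_val y f)))"

lemma place_val_mult: "f \<noteq> 0 \<Longrightarrow> g \<noteq> 0 \<Longrightarrow> place_val y (f * g) = place_val y f + place_val y g"
  and place_val_add:
    "f \<noteq> 0 \<Longrightarrow> g \<noteq> 0 \<Longrightarrow> f + g \<noteq> 0 \<Longrightarrow> min (place_val y f) (place_val y g) \<le> place_val y (f + g)"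
  and place_val_0: "place_val y 0 = 0"
  and place_val_normalised: "\<exists>f. f \<noteq> 0 \<and> place_val y f = 1"
  using place_val[of y] by (auto simp: normalised_valuation_def)

lemma place_val_1: "place_val y 1 = 0"
  using place_val_mult[of 1 1 y] by simp

lemma place_val_power: "f \<noteq> 0 \<Longrightarrow> place_val y (f ^ n) = int n * place_val y f"
  by (induction n) (simp_all add: place_val_1 place_val_mult algebra_simps)

lemma place_val_minus: "place_val y (- f) = place_val y f"
proof (cases "f = 0")
  case False
  have "place_val y ((- 1) * (- 1)) = place_val y (- 1) + place_val y (- 1)"
    by (rule place_val_mult) auto
  then have "place_val y (- 1) = 0" by (simp add: place_val_1)
  with False place_val_mult[of "- 1" f y] show ?thesis by simp
qed simp

lemma place_abs_0 [simp]: "place_abs y 0 = 0"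
  and place_abs_1 [simp]: "place_abs y 1 = 1"
  by (simp_all add: place_abs_def place_val_1)

lemma place_abs_nonneg [simp]: "place_abs y f \<ge> 0"
  by (simp add: place_abs_def)

lemma place_abs_mult: "place_abs y (f * g) = place_abs y f * place_abs y g"
  by (simp add: place_abs_def place_val_mult powr_add[symmetric] algebra_simps)

lemma place_abs_minus [simp]: "place_abs y (- f) = place_abs y f"
  by (simp add: place_abs_def place_val_minus)

lemma place_abs_minus_commute: "place_abs y (f - g) = place_abs y (g - f)"
  using place_abs_minus[of y "f - g"] by (simp del: place_abs_minus)

lemma place_abs_add: "place_abs y (f + g) \<le> max (place_abs y f) (place_abs y g)"
proof (cases "f = 0 \<or> g = 0 \<or> f + g = 0")
  case True
  then show ?thesis by (auto simp: le_max_iff_disj)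
next
  case False
  then have nz: "f \<noteq> 0" "g \<noteq> 0" "f + g \<noteq> 0" by auto
  have q: "real CARD('a) \<ge> 1" by simp
  have mono: "place_abs y f' \<le> place_abs y g'"
    if "f' \<noteq> 0" "g' \<noteq> 0" "place_val y g' \<le> place_val y f'" for f' g' :: "'a ratfun"
    using that q by (auto simp: place_abs_def intro!: powr_mono mult_left_mono)
  from place_val_add[OF nz, of y] show ?thesis
    using mono[of "f + g" f] mono[of "f + g" g] nz by (auto simp: min_def max_def split: if_splits)
qed

lemma place_abs_add_le: "place_abs y (f + g) \<le> place_abs y f + place_abs y g"
  using place_abs_add[of y f g] place_abs_nonneg[of y f] place_abs_nonneg[of y g] by linarith

lemma place_abs_diff_ineq: "\<bar>place_abs y f - place_abs y g\<bar> \<le> place_abs y (f - g)"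
  using place_abs_add_le[of y "f - g" g] place_abs_add_le[of y "g - f" f]
  by (simp add: place_abs_minus_commute[of y g f])


subsection \<open>A rational function has finitely many poles\<close>

lemma poly_to_ratfun_hom:
  "poly_to_ratfun (a + b) = poly_to_ratfun a + poly_to_ratfun b"
  "poly_to_ratfun (a * b) = poly_to_ratfun a * poly_to_ratfun b"
  "poly_to_ratfun 0 = 0" "poly_to_ratfun 1 = 1"
  by (simp_all add: poly_to_ratfun_def Zero_fract_def One_fract_def)

lemma poly_to_ratfun_power: "poly_to_ratfun (a ^ n) = poly_to_ratfun a ^ n"
  by (induction n) (simp_all add: poly_to_ratfun_hom)

lemma poly_to_ratfun_eq_0_iff [simp]: "poly_to_ratfun a = 0 \<longleftrightarrow> a = 0"
  by (simp add: poly_to_ratfun_def Zero_fract_def eq_fract)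

abbreviation poly_val :: "'a::{field, finite} place \<Rightarrow> 'a poly \<Rightarrow> int" where
  "poly_val y h \<equiv> place_val y (poly_to_ratfun h)"

lemma poly_val_mult: "a \<noteq> 0 \<Longrightarrow> b \<noteq> 0 \<Longrightarrow> poly_val y (a * b) = poly_val y a + poly_val y b"
  by (simp add: poly_to_ratfun_hom place_val_mult)

lemma poly_val_add:
  "a \<noteq> 0 \<Longrightarrow> b \<noteq> 0 \<Longrightarrow> a + b \<noteq> 0 \<Longrightarrow> min (poly_val y a) (poly_val y b) \<le> poly_val y (a + b)"
  using place_val_add[of "poly_to_ratfun a" "poly_to_ratfun b" y]
  by (simp add: poly_to_ratfun_hom(1)[symmetric])

lemma poly_val_uminus: "poly_val y (- a) = poly_val y a"
proof -
  have "poly_to_ratfun (- a) = - poly_to_ratfun a" by (simp add: poly_to_ratfun_def)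
  then show ?thesis by (simp add: place_val_minus)
qed

lemma poly_val_add_eq:
  assumes "a \<noteq> 0" "b \<noteq> 0" "poly_val y a < poly_val y b"
  shows "a + b \<noteq> 0" "poly_val y (a + b) = poly_val y a"
proof -
  show nz: "a + b \<noteq> 0"
  proof
    assume "a + b = 0"
    then have "a = - b" by (simp add: eq_neg_iff_add_eq_0)
    with assms show False by (simp add: poly_val_uminus)
  qed
  have "min (poly_val y (a + b)) (poly_val y (- b)) \<le> poly_val y ((a + b) + (- b))"
    using assms nz by (intro poly_val_add) auto
  then have "poly_val y (a + b) \<le> poly_val y a" using assms(3) by (simp add: poly_val_uminus min_def split: if_splits)
  with poly_val_add[OF assms(1,2) nz, of y] assms(3) show "poly_val y (a + b) = poly_val y a" by simp
qed

lemma place_val_Fract: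
  assumes "a \<noteq> 0" "b \<noteq> 0"
  shows "place_val y (Fract a b) = poly_val y a - poly_val y b"
proof -
  have "poly_to_ratfun a = Fract a b * poly_to_ratfun b"
    using assms by (simp add: poly_to_ratfun_def eq_fract)
  moreover have "Fract a b \<noteq> 0" using assms by (simp add: Zero_fract_def eq_fract)
  ultimately show ?thesis using assms by (simp add: place_val_mult)
qed

lemma poly_val_const:
  assumes "c \<noteq> 0"
  shows "poly_val y [:c:] = 0"
proof -
  have "\<not> inj (\<lambda>n::nat. c ^ n)"
    using finite[of "range (\<lambda>n::nat. c ^ n)"] finite_imageD infinite_UNIV_nat by blast
  then obtain m n where "m < n" "c ^ m = c ^ n"
    by (metis injI linorder_neqE_nat)
  then have "c ^ m * c ^ (n - m) = c ^ m * 1"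
    by (metis le_add_diff_inverse less_imp_le mult_1_right power_add)
  then have "c ^ (n - m) = 1" using assms by simp
  then have "[:c:] ^ (n - m) = 1" by (simp add: poly_const_pow)
  then have "place_val y (poly_to_ratfun [:c:] ^ (n - m)) = 0"
    by (simp add: poly_to_ratfun_power[symmetric] poly_to_ratfun_hom place_val_1)
  with assms \<open>m < n\<close> show ?thesis by (simp add: place_val_power)
qed

lemma poly_val_pCons:
  assumes "h \<noteq> 0"
  shows "pCons 0 h = [:0, 1:] * h" "poly_val y (pCons 0 h) = poly_val y [:0, 1:] + poly_val y h"
proof -
  show "pCons 0 h = [:0, 1:] * h" by simp
  then show "poly_val y (pCons 0 h) = poly_val y [:0, 1:] + poly_val y h"
    using assms poly_val_mult[of "[:0, 1:]" h y] by simp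
qed

lemma poly_val_infinite_place:
  assumes "poly_val y [:0, 1:] < 0" "h \<noteq> 0"
  shows "poly_val y h = poly_val y [:0, 1:] * int (degree h)"
  using assms(2)
proof (induction h)
  case (pCons c h)
  show ?case
  proof (cases "h = 0")
    case True
    with pCons show ?thesis by (simp add: poly_val_const)
  next
    case False
    have v: "poly_val y (pCons 0 h) = poly_val y [:0, 1:] * int (degree (pCons c h))"
      using False pCons.IH poly_val_pCons(2)[OF False, of y] by (simp add: algebra_simps)
    show ?thesis
    proof (cases "c = 0")
      case True
      with v show ?thesis by simp
    next
      case c: False
      have "poly_val y (pCons 0 h) < poly_val y [:c:]"
        unfolding v using False assms(1) c by (simp add: poly_val_const mult_neg_pos)
      with poly_val_add_eq(2)[of "pCons 0 h" "[:c:]" y] c False v show ?thesis by simp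
    qed
  qed
qed simp

lemma place_eqI:
  assumes "\<And>h. h \<noteq> 0 \<Longrightarrow> poly_val y h = poly_val z h"
  shows "y = z"
proof -
  have "place_val y f = place_val z f" for f
  proof (cases f)
    case (Fract a b)
    with assms show ?thesis
      by (cases "a = 0") (simp_all add: place_val_Fract fract_collapse place_val_0)
  qed
  then show ?thesis by (metis ext place_val_inject)
qed

lemma normalised_factor:
  assumes "\<And>h. h \<noteq> 0 \<Longrightarrow> poly_val y h = m * int (d h)"
  shows "\<bar>m\<bar> = 1"
proof -
  obtain f where f: "f \<noteq> 0" "place_val y f = 1" using place_val_normalised by blast
  obtain a b where ab: "f = Fract a b" "b \<noteq> 0" by (cases f)
  with f have "a \<noteq> 0" by (auto simp: fract_collapse)
  with ab f assms have "m * (int (d a) - int (d b)) = 1"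
    by (simp add: place_val_Fract algebra_simps)
  then show ?thesis by (simp add: zmult_eq_1_iff) auto
qed

lemma infinite_place_val_t:
  assumes "poly_val y [:0, 1:] < 0"
  shows "poly_val y [:0, 1:] = - 1"
proof -
  have "\<bar>poly_val y [:0, 1:]\<bar> = 1"
    by (rule normalised_factor[of y _ degree]) (rule poly_val_infinite_place[OF assms])
  with assms show ?thesis by linarith
qed

lemma infinite_place_unique:
  assumes "poly_val y [:0, 1:] < 0" "poly_val z [:0, 1:] < 0"
  shows "y = z"
proof (rule place_eqI)
  fix h :: "'a poly" assume h: "h \<noteq> 0"
  show "poly_val y h = poly_val z h"
    by (simp only: assms[THEN poly_val_infinite_place, OF h] assms[THEN infinite_place_val_t])
qed

lemma finite_infinite_places: "finite {y. poly_val y [:0, 1:] < 0}"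
proof (cases "\<exists>z :: 'a place. poly_val z [:0, 1:] < 0")
  case True
  then obtain z :: "'a place" where z: "poly_val z [:0, 1:] < 0" ..
  have "{y. poly_val y [:0, 1:] < 0} \<subseteq> {z}"
    by (intro subsetI) (simp only: mem_Collect_eq singleton_iff infinite_place_unique[OF _ z])
  then show ?thesis by (rule finite_subset) simp
next
  case False
  then have "{y :: 'a place. poly_val y [:0, 1:] < 0} = {}" by (simp only: Collect_empty_eq not_ex simp_thms)
  then show ?thesis by (simp only: finite.emptyI)
qed

lemma poly_val_finite_place_nonneg:
  assumes "poly_val y [:0, 1:] \<ge> 0" "h \<noteq> 0"
  shows "poly_val y h \<ge> 0"
  using assms(2)
proof (induction h)
  case (pCons c h)
  show ?case
  proof (cases "h = 0")
    case True
    with pCons show ?thesis by (simp add: poly_val_const)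
  next
    case False
    have v: "poly_val y (pCons 0 h) \<ge> 0"
      using False pCons.IH poly_val_pCons(2)[OF False, of y] assms(1) by simp
    show ?thesis
    proof (cases "c = 0")
      case True
      with v show ?thesis by simp
    next
      case c: False
      have "min (poly_val y (pCons 0 h)) (poly_val y [:c:]) \<le> poly_val y (pCons 0 h + [:c:])"
        using c False by (intro poly_val_add) simp_all
      with v c show ?thesis by (simp add: poly_val_const)
    qed
  qed
qed simp

definition poly_order :: "'a::field poly \<Rightarrow> 'a poly \<Rightarrow> nat" where
  "poly_order p h = (SOME k. \<exists>g. h = p ^ k * g \<and> \<not> p dvd g)"

lemma poly_order_decompose:
  fixes p h :: "'a::field poly"
  assumes "degree p > 0" "h \<noteq> 0"
  shows "\<exists>g. h = p ^ poly_order p h * g \<and> \<not> p dvd g"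
proof -
  have "\<exists>k g. h = p ^ k * g \<and> \<not> p dvd g"
    using assms(2)
  proof (induction "degree h" arbitrary: h rule: less_induct)
    case less
    show ?case
    proof (cases "p dvd h")
      case True
      then obtain g where g: "h = p * g" by (elim dvdE)
      with less.prems have "g \<noteq> 0" "p \<noteq> 0" by auto
      then have "degree g < degree h" using assms(1) g by (simp add: degree_mult_eq)
      from less.hyps[OF this \<open>g \<noteq> 0\<close>] obtain k g' where "g = p ^ k * g'" "\<not> p dvd g'"
        by (elim exE conjE)
      then have "h = p ^ Suc k * g' \<and> \<not> p dvd g'" by (simp add: g mult.assoc)
      then show ?thesis by (intro exI)
    next
      case False
      then have "h = p ^ 0 * h \<and> \<not> p dvd h" by simp
      then show ?thesis by (intro exI)
    qed
  qed
  then show ?thesis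
    unfolding poly_order_def by (rule someI_ex[of "\<lambda>k. \<exists>g. h = p ^ k * g \<and> \<not> p dvd g"])
qed

lemma poly_val_finite_place:
  assumes "poly_val y [:0, 1:] \<ge> 0" "p \<noteq> 0" "poly_val y p > 0"
    and min: "\<And>h. h \<noteq> 0 \<Longrightarrow> poly_val y h > 0 \<Longrightarrow> degree p \<le> degree h"
    and "h \<noteq> 0"
  shows "poly_val y h = int (poly_order p h)"
proof -
  have deg: "degree p > 0"
  proof (rule ccontr)
    assume "\<not> degree p > 0"
    then obtain c where c: "p = [:c:]" using degree_eq_zeroE[of p] by auto
    with assms(2) have "c \<noteq> 0" by simp
    with c assms(3) show False by (simp add: poly_val_const)
  qed
  have 0: "poly_val y g = 0" if "\<not> p dvd g" "g \<noteq> 0" for g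
  proof -
    have r: "g mod p \<noteq> 0" using that by (simp add: dvd_eq_mod_eq_0)
    then have "degree (g mod p) < degree p" using degree_mod_less[OF assms(2), of g] by simp
    then have v: "poly_val y (g mod p) = 0"
      using min[OF r] poly_val_finite_place_nonneg[OF assms(1) r] by force
    have eq: "g mod p + p * (g div p) = g" by simp
    show ?thesis
    proof (cases "g div p = 0")
      case True
      with eq v show ?thesis by simp
    next
      case False
      then have "poly_val y (p * (g div p)) > 0"
        using assms(2,3) poly_val_finite_place_nonneg[OF assms(1) False] by (simp add: poly_val_mult)
      then have "poly_val y (g mod p + p * (g div p)) = poly_val y (g mod p)"
        using r False assms(2) v by (intro poly_val_add_eq(2)) simp_all
      then show ?thesis unfolding eq v .
    qed
  qed
  have *: "poly_val y g = poly_val y p * int (poly_order p g)" if "g \<noteq> 0" for g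
  proof -
    obtain k where k: "g = p ^ poly_order p g * k" "\<not> p dvd k"
      using poly_order_decompose[OF deg \<open>g \<noteq> 0\<close>] by blast
    from k(2) have "k \<noteq> 0" by auto
    then have "poly_val y (p ^ poly_order p g * k) = poly_val y (p ^ poly_order p g) + poly_val y k"
      using assms(2) by (intro poly_val_mult) auto
    also have "\<dots> = poly_val y p * int (poly_order p g)"
      using 0[OF k(2) \<open>k \<noteq> 0\<close>] assms(2) by (simp add: poly_to_ratfun_power place_val_power)
    finally show ?thesis by (simp only: k(1)[symmetric])
  qed
  have "\<bar>poly_val y p\<bar> = 1" by (rule normalised_factor[OF *])
  with assms(3) have "poly_val y p = 1" by linarith
  with *[OF assms(5)] show ?thesis by simp
qed

lemma finite_polys_degree_le: "finite {p :: 'a::{field, finite} poly. degree p \<le> n}"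
proof (rule finite_subset)
  show "{p :: 'a poly. degree p \<le> n} \<subseteq> Poly ` {xs. set xs \<subseteq> UNIV \<and> length xs \<le> Suc n}"
  proof
    fix p :: "'a poly" assume p: "p \<in> {p. degree p \<le> n}"
    have "length (coeffs p) \<le> Suc n" using p by (cases "p = 0") (simp_all add: length_coeffs_degree)
    then show "p \<in> Poly ` {xs. set xs \<subseteq> UNIV \<and> length xs \<le> Suc n}"
      by (intro image_eqI[of _ _ "coeffs p"]) simp_all
  qed
  show "finite (Poly ` {xs :: 'a list. set xs \<subseteq> UNIV \<and> length xs \<le> Suc n})"
    by (intro finite_imageI finite_lists_length_le) simp
qed

lemma finite_zeros:
  fixes b :: "'a::{field, finite} poly"
  assumes "b \<noteq> 0"
  shows "finite {y. poly_val y [:0, 1:] \<ge> 0 \<and> poly_val y b > 0}" (is "finite ?S")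
proof -
  define good where "good y p \<longleftrightarrow> p \<noteq> 0 \<and> poly_val y p > 0 \<and>
    (\<forall>h. h \<noteq> 0 \<longrightarrow> poly_val y h > 0 \<longrightarrow> degree p \<le> degree h)" for y :: "'a place" and p
  have ex: "\<exists>p. good y p" if "y \<in> ?S" for y
  proof -
    from that assms have "\<exists>p. p \<noteq> 0 \<and> poly_val y p > 0" by blast
    from ex_has_least_nat[of "\<lambda>p. p \<noteq> 0 \<and> poly_val y p > 0" _ degree] this
    show ?thesis unfolding good_def by blast
  qed
  define gen where "gen y = (SOME p. good y p)" for y
  have gen: "good y (gen y)" if "y \<in> ?S" for y
    unfolding gen_def using ex[OF that] by (rule someI_ex)
  have inj: "inj_on gen ?S"
  proof (rule inj_onI, rule place_eqI)
    fix y z h assume yz: "y \<in> ?S" "z \<in> ?S" "gen y = gen z" and h: "(h :: 'a poly) \<noteq> 0"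
    have "poly_val y h = int (poly_order (gen y) h)" using yz gen[OF yz(1)] h
      by (intro poly_val_finite_place) (auto simp: good_def)
    moreover have "poly_val z h = int (poly_order (gen z) h)" using yz gen[OF yz(2)] h
      by (intro poly_val_finite_place) (auto simp: good_def)
    ultimately show "poly_val y h = poly_val z h" using yz by simp
  qed
  have "gen ` ?S \<subseteq> {p. degree p \<le> degree b}"
    using gen assms by (auto simp: good_def)
  then have "finite (gen ` ?S)" using finite_polys_degree_le finite_subset by blast
  then show ?thesis using inj by (rule finite_imageD)
qed

lemma finite_poles:
  fixes f :: "'a::{field, finite} ratfun"
  shows "finite {y. place_abs y f > 1}"
proof (cases "f = 0")
  case False
  obtain a b where ab: "f = Fract a b" "b \<noteq> 0" by (cases f)
  with False have a: "a \<noteq> 0" by (auto simp: fract_collapse)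
  have "{y. place_abs y f > 1} \<subseteq>
    {y. poly_val y [:0, 1:] < 0} \<union> {y. poly_val y [:0, 1:] \<ge> 0 \<and> poly_val y b > 0}"
  proof safe
    fix y :: "'a place" assume y: "place_abs y f > 1" "\<not> poly_val y [:0, 1:] < 0"
    have q: "real CARD('a) \<ge> 1" by simp
    have v: "place_val y f < 0"
    proof (rule ccontr)
      assume "\<not> place_val y f < 0"
      then have "real CARD('a) powr (- real (place_degree y) * real_of_int (place_val y f)) \<le> real CARD('a) powr 0"
        using q by (intro powr_mono) simp_all
      with y(1) False show False by (simp add: place_abs_def)
    qed
    show "poly_val y [:0, 1:] \<ge> 0" using y by simp
    then have "poly_val y a \<ge> 0" using a by (rule poly_val_finite_place_nonneg)
    with v a ab show "poly_val y b > 0" by (simp add: place_val_Fract)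
  qed
  then show ?thesis
    by (rule finite_subset) (intro finite_UnI finite_infinite_places finite_zeros[OF ab(2)])
qed simp


section \<open>Completions and adeles\<close>

text \<open>
  The completion \<open>F\<^sub>y\<close> is the quotient of the ring of \<open>\<bar>\<cdot>\<bar>\<^sub>y\<close>-Cauchy sequences in \<open>F\<close> by the ideal
  of null sequences, with \<open>\<bar>[X]\<bar>\<^sub>y = lim \<bar>X\<^sub>n\<bar>\<^sub>y\<close> and \<open>\<O>\<^sub>y = {a \<in> F\<^sub>y. \<bar>a\<bar>\<^sub>y \<le> 1}\<close>. As \<open>F\<^sub>y\<close> depends
  on the term \<open>y\<close> it is not a type of its own. The restricted product of the \<open>F\<^sub>y\<close> is: it is the
  quotient of the families of Cauchy sequences that represent elements of \<open>\<O>\<^sub>y\<close> for almost all \<open>y\<close>,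
  by the relation of representing the same element of \<open>F\<^sub>y\<close> at every \<open>y\<close>.
\<close>

definition place_Cauchy :: "'a::{field, finite} place \<Rightarrow> (nat \<Rightarrow> 'a ratfun) \<Rightarrow> bool" where
  "place_Cauchy y X \<longleftrightarrow> (\<forall>e>0. \<exists>M. \<forall>m\<ge>M. \<forall>n\<ge>M. place_abs y (X m - X n) < e)"

definition place_null :: "'a::{field, finite} place \<Rightarrow> (nat \<Rightarrow> 'a ratfun) \<Rightarrow> bool" where
  "place_null y X \<longleftrightarrow> (\<lambda>n. place_abs y (X n)) \<longlonglongrightarrow> 0"

definition completion_abs :: "'a::{field, finite} place \<Rightarrow> (nat \<Rightarrow> 'a ratfun) \<Rightarrow> real" where
  "completion_abs y X = lim (\<lambda>n. place_abs y (X n))"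

definition adele_family :: "('a::{field, finite} place \<Rightarrow> nat \<Rightarrow> 'a ratfun) \<Rightarrow> bool" where
  "adele_family \<alpha> \<longleftrightarrow> (\<forall>y. place_Cauchy y (\<alpha> y)) \<and> finite {y. \<not> completion_abs y (\<alpha> y) \<le> 1}"

definition adele_rel ::
    "('a::{field, finite} place \<Rightarrow> nat \<Rightarrow> 'a ratfun) \<Rightarrow> ('a place \<Rightarrow> nat \<Rightarrow> 'a ratfun) \<Rightarrow> bool" where
  "adele_rel \<alpha> \<beta> \<longleftrightarrow>
     adele_family \<alpha> \<and> adele_family \<beta> \<and> (\<forall>y. place_null y (\<lambda>n. \<alpha> y n - \<beta> y n))"

lemma place_null_0: "place_null y (\<lambda>n. 0)"
  by (simp add: place_null_def)

lemma place_null_add: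
  assumes "place_null y X" "place_null y Y"
  shows "place_null y (\<lambda>n. X n + Y n)"
  unfolding place_null_def
proof (rule tendsto_sandwich[of "\<lambda>_. 0"])
  show "(\<lambda>n. place_abs y (X n) + place_abs y (Y n)) \<longlonglongrightarrow> 0"
    using tendsto_add[OF assms[unfolded place_null_def]] by simp
qed (simp_all add: place_abs_add_le)

lemma place_null_minus: "place_null y X \<Longrightarrow> place_null y (\<lambda>n. - X n)"
  by (simp add: place_null_def)

lemma place_Cauchy_const: "place_Cauchy y (\<lambda>n. f)"
  by (simp add: place_Cauchy_def)

lemma completion_abs_const [simp]: "completion_abs y (\<lambda>n. f) = place_abs y f"
  by (simp add: completion_abs_def)

lemma place_Cauchy_minus: "place_Cauchy y X \<Longrightarrow> place_Cauchy y (\<lambda>n. - X n)"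
proof -
  have "place_abs y (- X m - - X n) = place_abs y (X m - X n)" for m n
    using place_abs_minus[of y "X m - X n"] by (simp del: place_abs_minus)
  then show "place_Cauchy y X \<Longrightarrow> place_Cauchy y (\<lambda>n. - X n)" by (simp add: place_Cauchy_def)
qed

lemma place_Cauchy_convergent:
  assumes "place_Cauchy y X"
  shows "(\<lambda>n. place_abs y (X n)) \<longlonglongrightarrow> completion_abs y X"
proof -
  have "Cauchy (\<lambda>n. place_abs y (X n))"
  proof (rule CauchyI)
    fix e :: real assume "e > 0"
    with assms obtain M where M: "\<And>m n. m \<ge> M \<Longrightarrow> n \<ge> M \<Longrightarrow> place_abs y (X m - X n) < e"
      unfolding place_Cauchy_def by blast
    have "norm (place_abs y (X m) - place_abs y (X n)) < e" if "m \<ge> M" "n \<ge> M" for m n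
      using M[OF that] place_abs_diff_ineq[of y "X m" "X n"] by simp
    then show "\<exists>M. \<forall>m\<ge>M. \<forall>n\<ge>M. norm (place_abs y (X m) - place_abs y (X n)) < e" by blast
  qed
  then show ?thesis
    unfolding completion_abs_def by (simp add: Cauchy_convergent convergent_LIMSEQ_iff[symmetric])
qed

lemma place_Cauchy_bounded:
  assumes "place_Cauchy y X"
  obtains B where "B > 0" "\<And>n. place_abs y (X n) \<le> B"
proof -
  have "Bseq (\<lambda>n. place_abs y (X n))"
    using place_Cauchy_convergent[OF assms] convergentI convergent_imp_Bseq by blast
  then obtain K where "K > 0" "\<And>n. norm (place_abs y (X n)) \<le> K" by (rule BseqE) blast
  with that show ?thesis by simp
qed

lemma place_Cauchy_add:
  assumes "place_Cauchy y X" "place_Cauchy y Y"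
  shows "place_Cauchy y (\<lambda>n. X n + Y n)"
  unfolding place_Cauchy_def
proof (intro allI impI)
  fix e :: real assume e: "e > 0"
  obtain M where M: "\<And>m n. m \<ge> M \<Longrightarrow> n \<ge> M \<Longrightarrow> place_abs y (X m - X n) < e"
    using assms(1) e unfolding place_Cauchy_def by blast
  obtain N where N: "\<And>m n. m \<ge> N \<Longrightarrow> n \<ge> N \<Longrightarrow> place_abs y (Y m - Y n) < e"
    using assms(2) e unfolding place_Cauchy_def by blast
  have "place_abs y ((X m + Y m) - (X n + Y n)) < e" if "m \<ge> max M N" "n \<ge> max M N" for m n
  proof -
    have eq: "(X m + Y m) - (X n + Y n) = (X m - X n) + (Y m - Y n)" by simp
    have "place_abs y (X m - X n) < e" "place_abs y (Y m - Y n) < e"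
      using that by (auto intro: M N)
    then show ?thesis
      unfolding eq using place_abs_add[of y "X m - X n" "Y m - Y n"] by linarith
  qed
  then show "\<exists>M. \<forall>m\<ge>M. \<forall>n\<ge>M. place_abs y ((X m + Y m) - (X n + Y n)) < e" by blast
qed

lemma place_Cauchy_mult:
  assumes "place_Cauchy y X" "place_Cauchy y Y"
  shows "place_Cauchy y (\<lambda>n. X n * Y n)"
  unfolding place_Cauchy_def
proof (intro allI impI)
  fix e :: real assume e: "e > 0"
  obtain B where B: "B > 0" "\<And>n. place_abs y (X n) \<le> B" using place_Cauchy_bounded[OF assms(1)] by blast
  obtain C where C: "C > 0" "\<And>n. place_abs y (Y n) \<le> C" using place_Cauchy_bounded[OF assms(2)] by blast
  obtain M where M: "\<And>m n. m \<ge> M \<Longrightarrow> n \<ge> M \<Longrightarrow> place_abs y (X m - X n) < e / C"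
    using assms(1) e C(1) unfolding place_Cauchy_def by (meson divide_pos_pos)
  obtain N where N: "\<And>m n. m \<ge> N \<Longrightarrow> n \<ge> N \<Longrightarrow> place_abs y (Y m - Y n) < e / B"
    using assms(2) e B(1) unfolding place_Cauchy_def by (meson divide_pos_pos)
  have "place_abs y (X m * Y m - X n * Y n) < e" if mn: "m \<ge> max M N" "n \<ge> max M N" for m n
  proof -
    have "X m * Y m - X n * Y n = (X m - X n) * Y m + X n * (Y m - Y n)" by (simp add: algebra_simps)
    moreover have "place_abs y ((X m - X n) * Y m) < e"
    proof -
      have "place_abs y ((X m - X n) * Y m) \<le> place_abs y (X m - X n) * C"
        by (simp add: place_abs_mult mult_left_mono C)
      also have "\<dots> < e" using M[of m n] mn C(1) by (simp add: pos_less_divide_eq)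
      finally show ?thesis .
    qed
    moreover have "place_abs y (X n * (Y m - Y n)) < e"
    proof -
      have "place_abs y (X n * (Y m - Y n)) \<le> B * place_abs y (Y m - Y n)"
        by (simp add: place_abs_mult mult_right_mono B)
      also have "\<dots> < e" using N[of m n] mn B(1) by (simp add: pos_less_divide_eq mult.commute)
      finally show ?thesis .
    qed
    ultimately show ?thesis
      using place_abs_add[of y "(X m - X n) * Y m" "X n * (Y m - Y n)"] by simp
  qed
  then show "\<exists>M. \<forall>m\<ge>M. \<forall>n\<ge>M. place_abs y (X m * Y m - X n * Y n) < e" by blast
qed

lemma completion_abs_mult:
  assumes "place_Cauchy y X" "place_Cauchy y Y"
  shows "completion_abs y (\<lambda>n. X n * Y n) = completion_abs y X * completion_abs y Y"
proof (rule LIMSEQ_unique[OF place_Cauchy_convergent[OF place_Cauchy_mult[OF assms]]])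
  show "(\<lambda>n. place_abs y (X n * Y n)) \<longlonglongrightarrow> completion_abs y X * completion_abs y Y"
    using tendsto_mult[OF assms[THEN place_Cauchy_convergent]] by (simp add: place_abs_mult)
qed

lemma completion_abs_nonneg: "place_Cauchy y X \<Longrightarrow> completion_abs y X \<ge> 0"
  by (rule LIMSEQ_le_const[OF place_Cauchy_convergent]) simp_all

lemma completion_abs_add:
  assumes "place_Cauchy y X" "place_Cauchy y Y"
  shows "completion_abs y (\<lambda>n. X n + Y n) \<le> max (completion_abs y X) (completion_abs y Y)"
  using LIMSEQ_le[OF place_Cauchy_convergent[OF place_Cauchy_add[OF assms]]
      tendsto_max[OF assms[THEN place_Cauchy_convergent]]]
  by (simp add: place_abs_add)

lemma completion_abs_minus [simp]: "completion_abs y (\<lambda>n. - X n) = completion_abs y X"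
  by (simp add: completion_abs_def)

lemma completion_abs_cong:
  assumes "place_Cauchy y X" "place_Cauchy y Y" "place_null y (\<lambda>n. X n - Y n)"
  shows "completion_abs y X = completion_abs y Y"
proof -
  have "(\<lambda>n. place_abs y (X n) - place_abs y (Y n)) \<longlonglongrightarrow> 0"
    using assms(3) unfolding place_null_def
    by (rule Lim_null_comparison[rotated]) (simp add: place_abs_diff_ineq)
  moreover have "(\<lambda>n. place_abs y (X n) - place_abs y (Y n)) \<longlonglongrightarrow> completion_abs y X - completion_abs y Y"
    using assms by (intro tendsto_diff place_Cauchy_convergent)
  ultimately show ?thesis using LIMSEQ_unique by fastforce
qed

lemma adele_family_const: "adele_family (\<lambda>y n. f)"
  using finite_poles[of f] by (simp add: adele_family_def place_Cauchy_const not_le)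

lemma adele_family_minus: "adele_family \<alpha> \<Longrightarrow> adele_family (\<lambda>y n. - \<alpha> y n)"
  by (simp add: adele_family_def place_Cauchy_minus)

lemma adele_family_add:
  assumes "adele_family \<alpha>" "adele_family \<beta>"
  shows "adele_family (\<lambda>y n. \<alpha> y n + \<beta> y n)"
proof -
  have c: "place_Cauchy y (\<alpha> y)" "place_Cauchy y (\<beta> y)" for y
    using assms by (auto simp: adele_family_def)
  have "{y. \<not> completion_abs y (\<lambda>n. \<alpha> y n + \<beta> y n) \<le> 1} \<subseteq>
        {y. \<not> completion_abs y (\<alpha> y) \<le> 1} \<union> {y. \<not> completion_abs y (\<beta> y) \<le> 1}"
  proof
    fix y assume "y \<in> {y. \<not> completion_abs y (\<lambda>n. \<alpha> y n + \<beta> y n) \<le> 1}"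
    with completion_abs_add[OF c(1)[of y] c(2)[of y]]
    show "y \<in> {y. \<not> completion_abs y (\<alpha> y) \<le> 1} \<union> {y. \<not> completion_abs y (\<beta> y) \<le> 1}"
      by (simp add: max_def split: if_splits)
  qed
  then show ?thesis
    using assms c by (auto simp: adele_family_def place_Cauchy_add intro: finite_subset)
qed

lemma adele_family_mult:
  assumes "adele_family \<alpha>" "adele_family \<beta>"
  shows "adele_family (\<lambda>y n. \<alpha> y n * \<beta> y n)"
proof -
  have c: "place_Cauchy y (\<alpha> y)" "place_Cauchy y (\<beta> y)" for y
    using assms by (auto simp: adele_family_def)
  have "{y. \<not> completion_abs y (\<lambda>n. \<alpha> y n * \<beta> y n) \<le> 1} \<subseteq>
        {y. \<not> completion_abs y (\<alpha> y) \<le> 1} \<union> {y. \<not> completion_abs y (\<beta> y) \<le> 1}"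
    using c by (auto simp: completion_abs_mult completion_abs_nonneg intro: mult_le_one)
  then show ?thesis
    using assms c by (auto simp: adele_family_def place_Cauchy_mult intro: finite_subset)
qed

lemma adele_relI:
  assumes "adele_family \<alpha>" "adele_family \<beta>" "\<And>y. place_null y (\<lambda>n. \<alpha> y n - \<beta> y n)"
  shows "adele_rel \<alpha> \<beta>"
  using assms by (simp only: adele_rel_def simp_thms)

lemma adele_relD:
  assumes "adele_rel \<alpha> \<beta>"
  shows "adele_family \<alpha>" "adele_family \<beta>" "place_null y (\<lambda>n. \<alpha> y n - \<beta> y n)"
  using assms unfolding adele_rel_def by blast+

lemma adele_rel_sym:
  assumes "adele_rel \<alpha> \<beta>"
  shows "adele_rel \<beta> \<alpha>"
proof (rule adele_relI[OF adele_relD(2,1)[OF assms]])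
  show "place_null y (\<lambda>n. \<beta> y n - \<alpha> y n)" for y
    using place_null_minus[OF adele_relD(3)[OF assms, of y]] by simp
qed

lemma adele_rel_trans:
  assumes "adele_rel \<alpha> \<beta>" "adele_rel \<beta> \<gamma>"
  shows "adele_rel \<alpha> \<gamma>"
proof (rule adele_relI[OF adele_relD(1)[OF assms(1)] adele_relD(2)[OF assms(2)]])
  show "place_null y (\<lambda>n. \<alpha> y n - \<gamma> y n)" for y
    using place_null_add[OF adele_relD(3)[OF assms(1), of y] adele_relD(3)[OF assms(2), of y]] by simp
qed

lemma adele_rel_refl: "adele_family \<alpha> \<Longrightarrow> adele_rel \<alpha> \<alpha>"
  by (simp add: adele_relI place_null_0)

lemma adele_rel_add:
  assumes "adele_rel \<alpha> \<alpha>'" "adele_rel \<beta> \<beta>'"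
  shows "adele_rel (\<lambda>y n. \<alpha> y n + \<beta> y n) (\<lambda>y n. \<alpha>' y n + \<beta>' y n)"
proof (rule adele_relI[OF adele_family_add[OF assms[THEN adele_relD(1)]]
      adele_family_add[OF assms[THEN adele_relD(2)]]])
  show "place_null y (\<lambda>n. \<alpha> y n + \<beta> y n - (\<alpha>' y n + \<beta>' y n))" for y
    using place_null_add[OF adele_relD(3)[OF assms(1), of y] adele_relD(3)[OF assms(2), of y]]
    by (simp only: add_diff_add)
qed

lemma adele_rel_minus:
  assumes "adele_rel \<alpha> \<alpha>'"
  shows "adele_rel (\<lambda>y n. - \<alpha> y n) (\<lambda>y n. - \<alpha>' y n)"
proof (rule adele_relI[OF adele_family_minus[OF adele_relD(1)[OF assms]]
      adele_family_minus[OF adele_relD(2)[OF assms]]])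
  show "place_null y (\<lambda>n. - \<alpha> y n - - \<alpha>' y n)" for y
    unfolding minus_diff_minus by (rule place_null_minus[OF adele_relD(3)[OF assms]])
qed

lemma place_null_mult:
  assumes "place_null y X" "place_Cauchy y Y"
  shows "place_null y (\<lambda>n. X n * Y n)"
proof -
  obtain B where B: "B > 0" "\<And>n. place_abs y (Y n) \<le> B" using place_Cauchy_bounded[OF assms(2)] by blast
  have "(\<lambda>n. place_abs y (X n) * B) \<longlonglongrightarrow> 0"
    using tendsto_mult_left_zero[OF assms(1)[unfolded place_null_def]] .
  then show ?thesis
    unfolding place_null_def
    by (rule tendsto_sandwich[of "\<lambda>_. 0", rotated 3]) (simp_all add: place_abs_mult mult_left_mono B)
qed

lemma adele_rel_mult:
  assumes "adele_rel \<alpha> \<alpha>'" "adele_rel \<beta> \<beta>'"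
  shows "adele_rel (\<lambda>y n. \<alpha> y n * \<beta> y n) (\<lambda>y n. \<alpha>' y n * \<beta>' y n)"
proof (rule adele_relI[OF adele_family_mult[OF assms[THEN adele_relD(1)]]
      adele_family_mult[OF assms[THEN adele_relD(2)]]])
  fix y
  have c: "place_Cauchy y (\<beta> y)" "place_Cauchy y (\<alpha>' y)"
    using adele_relD(1)[OF assms(2)] adele_relD(2)[OF assms(1)] by (simp_all add: adele_family_def)
  have "place_null y (\<lambda>n. (\<alpha> y n - \<alpha>' y n) * \<beta> y n + (\<beta> y n - \<beta>' y n) * \<alpha>' y n)"
    by (rule place_null_add[OF place_null_mult[OF adele_relD(3)[OF assms(1)] c(1)]
          place_null_mult[OF adele_relD(3)[OF assms(2)] c(2)]])
  then show "place_null y (\<lambda>n. \<alpha> y n * \<beta> y n - \<alpha>' y n * \<beta>' y n)"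
    by (simp add: algebra_simps)
qed

quotient_type (overloaded) 'a adele = "'a::{field, finite} place \<Rightarrow> nat \<Rightarrow> 'a ratfun" / partial: adele_rel
proof (rule part_equivpI)
  show "\<exists>\<alpha> :: 'a place \<Rightarrow> nat \<Rightarrow> 'a ratfun. adele_rel \<alpha> \<alpha>"
    using adele_rel_refl[OF adele_family_const] by blast
  show "symp (adele_rel :: ('a place \<Rightarrow> nat \<Rightarrow> 'a ratfun) \<Rightarrow> _)"
    by (rule sympI) (rule adele_rel_sym)
  show "transp (adele_rel :: ('a place \<Rightarrow> nat \<Rightarrow> 'a ratfun) \<Rightarrow> _)"
    by (rule transpI) (rule adele_rel_trans)
qed

definition principal_adele :: "'a::{field, finite} ratfun \<Rightarrow> 'a adele" where
  "principal_adele f = abs_adele (\<lambda>y n. f)"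

text \<open>\<open>adele_abs y a\<close> is \<open>\<bar>a\<^sub>y\<bar>\<^sub>y\<close>.\<close>

lift_definition adele_abs :: "'a::{field, finite} place \<Rightarrow> 'a adele \<Rightarrow> real" is
  "\<lambda>y \<alpha>. completion_abs y (\<alpha> y)"
  by (auto simp: adele_rel_def adele_family_def intro: completion_abs_cong)

instantiation adele :: ("{field, finite}") comm_ring_1
begin

lift_definition zero_adele :: "'a adele" is "\<lambda>y n. 0"
  by (simp add: adele_rel_refl adele_family_const)

lift_definition one_adele :: "'a adele" is "\<lambda>y n. 1"
  by (simp add: adele_rel_refl adele_family_const)

lift_definition plus_adele :: "'a adele \<Rightarrow> 'a adele \<Rightarrow> 'a adele" is "\<lambda>\<alpha> \<beta> y n. \<alpha> y n + \<beta> y n"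
  by (rule adele_rel_add)

lift_definition times_adele :: "'a adele \<Rightarrow> 'a adele \<Rightarrow> 'a adele" is "\<lambda>\<alpha> \<beta> y n. \<alpha> y n * \<beta> y n"
  by (rule adele_rel_mult)

lift_definition uminus_adele :: "'a adele \<Rightarrow> 'a adele" is "\<lambda>\<alpha> y n. - \<alpha> y n"
  by (rule adele_rel_minus)

definition minus_adele :: "'a adele \<Rightarrow> 'a adele \<Rightarrow> 'a adele" where
  "a - b = a + (- b :: 'a adele)"

lemma adele_rel_eq: "adele_family \<alpha> \<Longrightarrow> \<alpha> = \<beta> \<Longrightarrow> adele_rel \<alpha> \<beta>"
  by (simp add: adele_rel_refl)

instance
proof
  fix a b c :: "'a adele"
  note fam = adele_rel_def adele_family_add adele_family_mult adele_family_const adele_family_minus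
  show "a * b * c = a * (b * c)"
    by transfer (rule adele_rel_eq; simp add: fam algebra_simps)
  show "a * b = b * a"
    by transfer (rule adele_rel_eq; simp add: fam algebra_simps)
  show "1 * a = a"
    by transfer (rule adele_rel_eq; simp add: fam)
  show "a + b + c = a + (b + c)"
    by transfer (rule adele_rel_eq; simp add: fam algebra_simps)
  show "a + b = b + a"
    by transfer (rule adele_rel_eq; simp add: fam algebra_simps)
  show "0 + a = a"
    by transfer (rule adele_rel_eq; simp add: fam)
  show "- a + a = 0"
    by transfer (rule adele_rel_eq; simp add: fam)
  show "a - b = a + - b"
    by (rule minus_adele_def)
  show "(a + b) * c = a * c + b * c"
    by transfer (rule adele_rel_eq; simp add: fam algebra_simps)
  show "(0 :: 'a adele) \<noteq> 1"
    by transfer (simp add: adele_rel_def place_null_def LIMSEQ_const_iff)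
qed

end

lemma principal_adele_0: "principal_adele 0 = 0"
  by (simp add: principal_adele_def zero_adele_def)

lemma principal_adele_add: "principal_adele (f + g) = principal_adele f + principal_adele g"
  unfolding principal_adele_def by (simp add: plus_adele.abs_eq adele_rel_refl adele_family_const)

lemma principal_adele_minus: "principal_adele (- f) = - principal_adele f"
  unfolding principal_adele_def by (simp add: uminus_adele.abs_eq adele_rel_refl adele_family_const)

text \<open>
  The restricted product topology. The sets \<open>{c. \<bar>c\<^sub>y\<bar>\<^sub>y \<le> 1 for all y and \<bar>c\<^sub>y\<bar>\<^sub>y < e for y \<in> S}\<close>, with
  \<open>S\<close> finite and \<open>e > 0\<close>, are a neighbourhood base of \<open>0\<close>.
\<close>

definition adele_nhd :: "'a::{field, finite} place set \<Rightarrow> real \<Rightarrow> 'a adele \<Rightarrow> 'a adele set" where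
  "adele_nhd S e a = {b. (\<forall>y. adele_abs y (b - a) \<le> 1) \<and> (\<forall>y\<in>S. adele_abs y (b - a) < e)}"

instantiation adele :: ("{field, finite}") topological_space
begin

definition open_adele :: "'a adele set \<Rightarrow> bool" where
  "open_adele U \<longleftrightarrow> (\<forall>a\<in>U. \<exists>S e. finite S \<and> e > 0 \<and> adele_nhd S e a \<subseteq> U)"

instance
proof
  show "open (UNIV :: 'a adele set)"
    unfolding open_adele_def by (auto intro: exI[of _ "{}"] exI[of _ "1::real"])
next
  fix U V :: "'a adele set"
  assume UV: "open U" "open V"
  show "open (U \<inter> V)"
    unfolding open_adele_def
  proof
    fix a assume "a \<in> U \<inter> V"
    with UV obtain S e T d where
      "finite S" "e > 0" "adele_nhd S e a \<subseteq> U" "finite T" "d > 0" "adele_nhd T d a \<subseteq> V"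
      unfolding open_adele_def by (meson IntE)
    moreover have "adele_nhd (S \<union> T) (min e d) a \<subseteq> adele_nhd S e a \<inter> adele_nhd T d a"
      by (auto simp: adele_nhd_def)
    ultimately show "\<exists>S e. finite S \<and> e > 0 \<and> adele_nhd S e a \<subseteq> U \<inter> V"
      by (intro exI[of _ "S \<union> T"] exI[of _ "min e d"]) auto
  qed
next
  fix \<U> :: "'a adele set set"
  assume *: "\<forall>U\<in>\<U>. open U"
  show "open (\<Union>\<U>)"
    unfolding open_adele_def
  proof
    fix a assume "a \<in> \<Union>\<U>"
    then obtain U where "U \<in> \<U>" "a \<in> U" by blast
    with * show "\<exists>S e. finite S \<and> e > 0 \<and> adele_nhd S e a \<subseteq> \<Union>\<U>"
      unfolding open_adele_def by (meson Sup_upper order_trans)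
  qed
qed

end


section \<open>The quotient of the adeles by the function field\<close>

text \<open>
  For \<open>G = GL\<^sub>2\<close> the unipotent radical \<open>U\<close> is isomorphic to the additive group, so
  \<open>U(F)\U(\<bbbA>)\<close> is \<open>\<bbbA>/F\<close>. Its topology is the quotient topology.
\<close>

quotient_type (overloaded) 'a adele_class = "'a::{field, finite} adele" /
  "\<lambda>a b. \<exists>f. a = principal_adele f + b"
proof (rule equivpI)
  show "reflp (\<lambda>a b :: 'a adele. \<exists>f. a = principal_adele f + b)"
    by (rule reflpI) (metis add_0 principal_adele_0)
  show "symp (\<lambda>a b :: 'a adele. \<exists>f. a = principal_adele f + b)"
  proof (rule sympI)
    fix a b :: "'a adele" assume "\<exists>f. a = principal_adele f + b"
    then obtain f where "a = principal_adele f + b" by blast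
    then have "b = principal_adele (- f) + a" by (simp add: principal_adele_minus)
    then show "\<exists>f. b = principal_adele f + a" by blast
  qed
  show "transp (\<lambda>a b :: 'a adele. \<exists>f. a = principal_adele f + b)"
    by (rule transpI) (metis add.assoc principal_adele_add)
qed

instantiation adele_class :: ("{field, finite}") topological_space
begin

definition open_adele_class :: "'a adele_class set \<Rightarrow> bool" where
  "open_adele_class V \<longleftrightarrow> open (abs_adele_class -` V)"

instance
  by standard (auto simp: open_adele_class_def vimage_Union)

end

definition translate :: "'a::{field, finite} adele \<Rightarrow> 'a adele_class \<Rightarrow> 'a adele_class" where
  "translate c u = abs_adele_class (c + rep_adele_class u)"

lemma abs_adele_class_eq_iff:
  "abs_adele_class a = abs_adele_class b \<longleftrightarrow> (\<exists>f. a = principal_adele f + b)"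
  by (rule adele_class.abs_eq_iff)

lemma translate_abs: "translate c (abs_adele_class a) = abs_adele_class (c + a)"
proof -
  have "abs_adele_class (rep_adele_class (abs_adele_class a)) = abs_adele_class a"
    by (rule Quotient3_abs_rep[OF Quotient3_adele_class])
  then obtain f where "rep_adele_class (abs_adele_class a) = principal_adele f + a"
    unfolding abs_adele_class_eq_iff by blast
  then have "c + rep_adele_class (abs_adele_class a) = principal_adele f + (c + a)"
    by (simp add: algebra_simps)
  then show ?thesis unfolding translate_def abs_adele_class_eq_iff by blast
qed

text \<open>
  Since \<open>\<bbbA>/F\<close> is a compact group, its Haar measures are its nonzero finite translation
  invariant Borel measures.
\<close>

definition haar_measure :: "'a::{field, finite} adele_class measure \<Rightarrow> bool" where
  "haar_measure \<mu> \<longleftrightarrow>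
     sets \<mu> = sets borel \<and>
     finite_measure \<mu> \<and>
     emeasure \<mu> (space \<mu>) \<noteq> 0 \<and>
     (\<forall>c. \<forall>B\<in>sets borel. emeasure \<mu> (translate c ` B) = emeasure \<mu> B)"


section \<open>Automorphic forms and cusp forms on GL(2)\<close>

definition GL2 :: "('r::comm_ring_1 ^ 2 ^ 2) set" where
  "GL2 = {g. invertible g}"

definition GL2_center :: "('a::{field, finite} adele ^ 2 ^ 2) set" where
  "GL2_center = {z \<in> GL2. \<forall>g\<in>GL2. z ** g = g ** z}"

definition principal_matrix :: "'a::{field, finite} ratfun ^ 2 ^ 2 \<Rightarrow> 'a adele ^ 2 ^ 2" where
  "principal_matrix = map_matrix principal_adele"

definition unipotent :: "'a::{field, finite} adele \<Rightarrow> 'a adele ^ 2 ^ 2" where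
  "unipotent a = vector [vector [1, a], vector [0, 1]]"

definition local_height :: "'a::{field, finite} place \<Rightarrow> 'a adele ^ 2 ^ 2 \<Rightarrow> real" where
  "local_height y g = Max (insert (inverse (adele_abs y (det g))) {adele_abs y (g $ i $ j) | i j. True})"

text \<open>For \<open>g\<close> in \<open>G(\<bbbA>)\<close> almost all factors are \<open>1\<close>.\<close>

definition height :: "'a::{field, finite} adele ^ 2 ^ 2 \<Rightarrow> real" where
  "height g = (\<Prod>y. local_height y g)"

definition moderate_growth :: "('a::{field, finite} adele ^ 2 ^ 2 \<Rightarrow> complex) \<Rightarrow> bool" where
  "moderate_growth f \<longleftrightarrow> (\<exists>C N. \<forall>g\<in>GL2. cmod (f g) \<le> C * height g powr N)"

text \<open>
  \<open>integral_at y g\<close> says that the component of \<open>g\<close> at \<open>y\<close> lies in \<open>GL\<^sub>2(\<O>\<^sub>y)\<close>, and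
  \<open>congruent_one_at y g\<close> that its entries agree with those of the identity modulo
  \<open>\<pi>\<^sub>y\<O>\<^sub>y = {a \<in> F\<^sub>y. \<bar>a\<bar>\<^sub>y < 1}\<close>.
\<close>

definition integral_at :: "'a::{field, finite} place \<Rightarrow> 'a adele ^ 2 ^ 2 \<Rightarrow> bool" where
  "integral_at y g \<longleftrightarrow> (\<forall>i j. adele_abs y (g $ i $ j) \<le> 1) \<and> adele_abs y (det g) = 1"

definition congruent_one_at :: "'a::{field, finite} place \<Rightarrow> 'a adele ^ 2 ^ 2 \<Rightarrow> bool" where
  "congruent_one_at y g \<longleftrightarrow> (\<forall>i j. adele_abs y ((g - mat 1) $ i $ j) < 1)"

definition level_subgroup :: "'a::{field, finite} place \<Rightarrow> ('a adele ^ 2 ^ 2) set" where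
  "level_subgroup x = {k \<in> GL2. (\<forall>y. integral_at y k) \<and> congruent_one_at x k}"

text \<open>
  A function on \<open>G(\<bbbA>)\<close> is represented by its extension by zero to all \<open>2 \<times> 2\<close> adelic matrices.
\<close>

definition automorphic_forms ::
    "('a::{field, finite} adele ^ 2 ^ 2) set \<Rightarrow> ('a adele ^ 2 ^ 2 \<Rightarrow> complex) set" where
  "automorphic_forms K' =
     {f. (\<forall>g. g \<notin> GL2 \<longrightarrow> f g = 0) \<and>
         (\<forall>\<gamma>\<in>GL2. \<forall>g\<in>GL2. f (principal_matrix \<gamma> ** g) = f g) \<and>
         (\<forall>z\<in>GL2_center. \<forall>g\<in>GL2. f (z ** g) = f g) \<and>
         (\<forall>k\<in>K'. \<forall>g\<in>GL2. f (g ** k) = f g) \<and>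
         moderate_growth f}"

text \<open>
  For \<open>f\<close> left \<open>G(F)\<close>-invariant, \<open>f (unipotent a ** g)\<close> depends on \<open>a\<close> only through its class in
  \<open>\<bbbA>/F\<close>, so the choice of representative by \<open>rep_adele_class\<close> does not matter.
\<close>

definition constant_term ::
    "'a::{field, finite} adele_class measure \<Rightarrow> ('a adele ^ 2 ^ 2 \<Rightarrow> complex) \<Rightarrow> 'a adele ^ 2 ^ 2 \<Rightarrow> complex" where
  "constant_term \<mu> f g = (\<integral>u. f (unipotent (rep_adele_class u) ** g) \<partial>\<mu>)"

definition cusp_forms ::
    "'a::{field, finite} adele_class measure \<Rightarrow> ('a adele ^ 2 ^ 2) set \<Rightarrow> ('a adele ^ 2 ^ 2 \<Rightarrow> complex) set" where
  "cusp_forms \<mu> K' = {f \<in> automorphic_forms K'. \<forall>g\<in>GL2. constant_term \<mu> f g = 0}"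

end

theory Submission
  imports Defs
begin

text \<open>
  The reason is the vanishing of \<open>H\<^sup>1(\<bbbP>\<^sup>1, O(-x))\<close> for a point \<open>x\<close> of degree one, which in adelic
  terms is \<open>\<bbbA> = F + O(-x)\<close>, where \<open>O(-x)\<close> denotes the adeles that are integral everywhere and
  congruent to \<open>0\<close> at \<open>x\<close> (\<open>strong_approximation\<close>). It is proved by partial fractions, one pole at a
  time, with polynomials in a function whose only pole is \<open>x\<close>; degree one enters because the
  residue field at \<open>x\<close> then consists of constants.

  Write \<open>u(a)\<close> for the unipotent matrices and \<open>K\<close> for the product of all \<open>GL\<^sub>2(\<O>\<^sub>y)\<close>. By the
  Iwasawa decomposition, and since every idele agrees outside \<open>x\<close> with an element of \<open>F\<close> up to units
  (\<open>class_number_one\<close>), the values of an automorphic form are its values at \<open>g = u(a) diag(s, 1) k\<close>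
  with \<open>k \<in> K\<close> and \<open>s\<close> a unit outside \<open>x\<close>.

  If \<open>\<bar>s\<bar>\<^sub>x \<ge> 1\<close>, the vector bundle of \<open>g\<close> has a line subbundle whose degree is at least that of the
  quotient. Then \<open>s\<^sup>-\<^sup>1 O(-x)\<close> lies in \<open>O(-x)\<close>, so moving \<open>u(b)\<close> with \<open>b \<in> O(-x)\<close> to the right across
  \<open>diag(s, 1) k\<close> gives an element of \<open>K'\<close>; here it matters that \<open>K'\<close> is normal in \<open>K\<close>. Together with
  invariance under \<open>u(F)\<close> and \<open>\<bbbA> = F + O(-x)\<close> this makes \<open>a' \<mapsto> f(u(a') g)\<close> constant, so the
  constant term at \<open>g\<close> is a nonzero multiple of \<open>f(g)\<close>, and \<open>f(g) = 0\<close> for a cusp form.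

  If \<open>\<bar>s\<bar>\<^sub>x < 1\<close>, translate \<open>a\<close> into \<open>O(-x)\<close> by an element of \<open>F\<close> and apply the Weyl element. The new
  bottom row is \<open>(s, a)\<close>; its norm is \<open>1\<close> outside \<open>x\<close> and less than \<open>1\<close> at \<open>x\<close>, and the Iwasawa
  decomposition of the result has an \<open>s'\<close> with \<open>\<bar>s'\<bar>\<^sub>x = \<bar>s\<bar>\<^sub>x / max(\<bar>s\<bar>\<^sub>x, \<bar>a\<bar>\<^sub>x)\<^sup>2 > \<bar>s\<bar>\<^sub>x\<close>. As absolute values
  are discrete, finitely many such steps lead to the first case (\<open>cusp_form_zero_on_borel\<close>).
\<close>

section \<open>Valuations\<close>

text \<open>
  The sets \<open>m\<^sub>y\<^sup>n\<close> of the valuation filtration; the disjunct \<open>f = 0\<close> stands for \<open>v(0) = \<infinity>\<close>.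
\<close>

definition val_ge :: "'a::{field, finite} place \<Rightarrow> int \<Rightarrow> 'a ratfun \<Rightarrow> bool" where
  "val_ge y n f \<longleftrightarrow> f = 0 \<or> n \<le> place_val y f"

lemma val_ge_zero [simp]: "val_ge y n 0"
  by (simp add: val_ge_def)

lemma val_ge_minus [simp]: "val_ge y n (- f) \<longleftrightarrow> val_ge y n f"
  by (simp add: val_ge_def place_val_minus)

lemma val_ge_add: "val_ge y n f \<Longrightarrow> val_ge y n g \<Longrightarrow> val_ge y n (f + g)"
  using place_val_add[of f g y] by (cases "f = 0 \<or> g = 0 \<or> f + g = 0") (auto simp: val_ge_def)

lemma val_ge_diff: "val_ge y n f \<Longrightarrow> val_ge y n g \<Longrightarrow> val_ge y n (f - g)"
  using val_ge_add[of y n f "- g"] by simp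

lemma val_ge_mult: "val_ge y m f \<Longrightarrow> val_ge y n g \<Longrightarrow> val_ge y (m + n) (f * g)"
  by (cases "f = 0 \<or> g = 0") (auto simp: val_ge_def place_val_mult)

lemma val_ge_mono: "val_ge y n f \<Longrightarrow> m \<le> n \<Longrightarrow> val_ge y m f"
  by (auto simp: val_ge_def)

lemma val_ge_one [simp]: "val_ge y n 1 \<longleftrightarrow> n \<le> 0"
  by (simp add: val_ge_def place_val_1)

lemma poly_to_ratfun_diff: "poly_to_ratfun (a - b) = poly_to_ratfun a - poly_to_ratfun b"
  by (simp add: poly_to_ratfun_def)

lemma val_ge_const [simp]: "val_ge y 0 (poly_to_ratfun [:c:])"
  by (cases "c = 0") (auto simp: val_ge_def poly_val_const)

lemma place_val_inverse: "place_val y (inverse f) = - place_val y f"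
proof (cases "f = 0")
  case False
  then have "place_val y (f * inverse f) = place_val y f + place_val y (inverse f)"
    by (intro place_val_mult) auto
  with False show ?thesis by (simp add: place_val_1)
qed (simp add: place_val_0)

lemma place_val_divide:
  "f \<noteq> 0 \<Longrightarrow> g \<noteq> 0 \<Longrightarrow> place_val y (f / g) = place_val y f - place_val y g"
  by (simp add: divide_inverse place_val_mult place_val_inverse)

lemma Fract_eq_divide: "b \<noteq> 0 \<Longrightarrow> Fract a b = poly_to_ratfun a / poly_to_ratfun b"
  by (simp add: poly_to_ratfun_def divide_fract eq_fract)

lemma ratfun_cases:
  obtains a b where "b \<noteq> 0" "f = poly_to_ratfun a / poly_to_ratfun b"
  by (cases f) (metis Fract_eq_divide)

lemma poly_val_pos_imp_degree:
  assumes "h \<noteq> 0" "poly_val y h \<noteq> 0"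
  shows "degree h > 0"
proof (rule ccontr)
  assume "\<not> degree h > 0"
  then obtain c where "h = [:c:]" using degree_eq_zeroE[of h] by auto
  with assms show False by (simp add: poly_val_const)
qed

text \<open>
  The nonzero polynomials of positive value and \<open>0\<close> form a prime ideal, and a member of least
  degree generates it.
\<close>

lemma finite_place_generator:
  assumes fin: "poly_val y [:0, 1:] \<ge> 0"
  obtains p where "p \<noteq> 0" "degree p > 0" "poly_val y p = 1"
    "\<And>h. h \<noteq> 0 \<Longrightarrow> poly_val y h > 0 \<longleftrightarrow> p dvd h"
    "\<And>h. h \<noteq> 0 \<Longrightarrow> poly_val y h = int (poly_order p h)"
proof -
  have "\<exists>a. a \<noteq> 0 \<and> poly_val y a > 0"
  proof -
    obtain f where f: "f \<noteq> 0" "place_val y f = 1" using place_val_normalised by blast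
    obtain a b where ab: "b \<noteq> 0" "f = poly_to_ratfun a / poly_to_ratfun b" by (rule ratfun_cases)
    with f have a: "a \<noteq> 0" by auto
    with ab f have "poly_val y a = 1 + poly_val y b" by (simp add: place_val_divide)
    with poly_val_finite_place_nonneg[OF fin ab(1)] a show ?thesis by force
  qed
  from ex_has_least_nat[of "\<lambda>p. p \<noteq> 0 \<and> poly_val y p > 0" _ degree] this
  obtain p where p: "p \<noteq> 0" "poly_val y p > 0"
    and min: "\<And>h. h \<noteq> 0 \<Longrightarrow> poly_val y h > 0 \<Longrightarrow> degree p \<le> degree h" by blast
  have deg: "degree p > 0" using p by (intro poly_val_pos_imp_degree[of p y]) auto
  have ord: "poly_val y h = int (poly_order p h)" if "h \<noteq> 0" for h
    by (rule poly_val_finite_place[OF fin p min that])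
  have dvd: "poly_val y h > 0 \<longleftrightarrow> p dvd h" if h: "h \<noteq> 0" for h
  proof
    assume "poly_val y h > 0"
    with ord[OF h] have "poly_order p h \<noteq> 0" by simp
    with poly_order_decompose[OF deg h] show "p dvd h"
      by (metis dvd_mult2 dvd_power neq0_conv)
  next
    assume "p dvd h"
    then obtain k where k: "h = p * k" by (elim dvdE)
    with h have "k \<noteq> 0" by auto
    with k p poly_val_finite_place_nonneg[OF fin this] show "poly_val y h > 0"
      by (simp add: poly_val_mult)
  qed
  have "poly_val y p = 1"
  proof -
    obtain g where g: "p = p ^ poly_order p p * g" using poly_order_decompose[OF deg p(1)] by blast
    with p have "g \<noteq> 0" by auto
    then have "degree (p ^ poly_order p p * g) = poly_order p p * degree p + degree g"
      using p by (simp add: degree_mult_eq degree_power_eq)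
    with g have "degree p = poly_order p p * degree p + degree g" by simp
    moreover have "poly_order p p > 0" using ord[OF p(1)] p(2) by simp
    ultimately have "poly_order p p = 1"
      using deg by (cases "poly_order p p"; cases "poly_order p p - 1") auto
    with ord[OF p(1)] show ?thesis by simp
  qed
  with that p(1) deg dvd ord show ?thesis by blast
qed

text \<open>
  Multiplication by \<open>b\<close> is injective on the finite set of residues modulo \<open>p\<close>, hence surjective.
\<close>

lemma solve_congruence_mod_prime_poly:
  fixes p :: "'a::{field, finite} poly"
  assumes deg: "degree p > 0" and prime: "\<And>g h. p dvd g * h \<Longrightarrow> p dvd g \<or> p dvd h"
    and b: "\<not> p dvd b"
  shows "\<exists>r. degree r < degree p \<and> p dvd a - b * r"
proof -
  define R where "R = {r :: 'a poly. degree r < degree p}"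
  have p0: "p \<noteq> 0" using deg by auto
  have fin: "finite R"
    unfolding R_def by (rule finite_subset[OF _ finite_polys_degree_le[of "degree p"]]) auto
  have mod: "h mod p \<in> R" for h
    unfolding R_def using degree_mod_less[OF p0, of h] deg by auto
  have "inj_on (\<lambda>r. (b * r) mod p) R"
  proof (rule inj_onI)
    fix r s assume rs: "r \<in> R" "s \<in> R" "(b * r) mod p = (b * s) mod p"
    then have "p dvd b * (r - s)" by (simp add: mod_eq_dvd_iff algebra_simps)
    with prime b have dvd: "p dvd r - s" by blast
    have "degree (r - s) < degree p"
      using rs deg by (simp add: R_def degree_diff_less)
    with dvd have "r - s = 0" by (meson dvd_imp_degree_le leD)
    then show "r = s" by simp
  qed
  then have "(\<lambda>r. (b * r) mod p) ` R = R"
    using mod fin by (intro endo_inj_surj) auto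
  with mod[of a] obtain r where "r \<in> R" "a mod p = (b * r) mod p" by blast
  then show ?thesis by (auto simp: R_def mod_eq_dvd_iff)
qed

text \<open>
  After cancelling powers of \<open>p\<close> the denominator is prime to \<open>p\<close>, so it can be inverted modulo \<open>p\<close>.
\<close>

lemma residue_representative_finite_place:
  assumes fin: "poly_val y [:0, 1:] \<ge> 0" and "p \<noteq> 0" "degree p > 0" "poly_val y p = 1"
    and dvd: "\<And>h. h \<noteq> 0 \<Longrightarrow> poly_val y h > 0 \<longleftrightarrow> p dvd h"
    and ord: "\<And>h. h \<noteq> 0 \<Longrightarrow> poly_val y h = int (poly_order p h)"
    and f: "val_ge y 0 f"
  obtains r where "degree r < degree p" "val_ge y 1 (f - poly_to_ratfun r)"
proof (cases "val_ge y 1 f")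
  case True
  with that[of 0] assms show ?thesis by (simp add: poly_to_ratfun_hom)
next
  case False
  with f have f0: "f \<noteq> 0" "place_val y f = 0" by (auto simp: val_ge_def)
  obtain a b where ab: "b \<noteq> 0" "f = poly_to_ratfun a / poly_to_ratfun b" by (rule ratfun_cases)
  with f0 have a: "a \<noteq> 0" by auto
  have prime: "p dvd g \<or> p dvd h" if gh: "p dvd g * h" for g h
  proof (cases "g = 0 \<or> h = 0")
    case nz: False
    with dvd[of "g * h"] gh have "poly_val y g + poly_val y h > 0" by (auto simp: poly_val_mult)
    then have "poly_val y g > 0 \<or> poly_val y h > 0" by linarith
    with dvd nz show ?thesis by blast
  qed auto
  have "poly_val y a = poly_val y b" using f0 ab a by (simp add: place_val_divide)
  with ord a ab have eq: "poly_order p a = poly_order p b" by simp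
  obtain a' where a': "a = p ^ poly_order p b * a'" 
    using poly_order_decompose[OF assms(3) a] eq by auto
  obtain b' where b': "b = p ^ poly_order p b * b'" "\<not> p dvd b'"
    using poly_order_decompose[OF assms(3) ab(1)] by auto
  have b'0: "b' \<noteq> 0" using b' by auto
  obtain r where r: "degree r < degree p" "p dvd a' - b' * r"
    using solve_congruence_mod_prime_poly[OF assms(3) prime b'(2)] by blast
  have "f = poly_to_ratfun (p ^ poly_order p b * a') / poly_to_ratfun (p ^ poly_order p b * b')"
    using ab(2) a' b'(1) by simp
  then have "f = poly_to_ratfun a' / poly_to_ratfun b'"
    using assms(2) by (simp add: poly_to_ratfun_hom poly_to_ratfun_power)
  then have quot: "f - poly_to_ratfun r = poly_to_ratfun (a' - b' * r) / poly_to_ratfun b'"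
    using b'0 by (simp add: poly_to_ratfun_diff poly_to_ratfun_hom field_simps)
  have v: "poly_val y b' = 0"
    using dvd[OF b'0] b'(2) poly_val_finite_place_nonneg[OF fin b'0] by auto
  have num: "a' - b' * r = 0 \<or> 1 \<le> poly_val y (a' - b' * r)"
    using dvd[of "a' - b' * r"] r(2) by linarith
  have "val_ge y 1 (poly_to_ratfun d / poly_to_ratfun b')" if "d = 0 \<or> 1 \<le> poly_val y d" for d
    using that b'0 v by (cases "d = 0") (auto simp: val_ge_def place_val_divide poly_to_ratfun_hom)
  from this[OF num] have "val_ge y 1 (f - poly_to_ratfun r)" unfolding quot .
  with that r show ?thesis by blast
qed

lemma poly_val_infinity:
  "poly_val y [:0, 1:] < 0 \<Longrightarrow> h \<noteq> 0 \<Longrightarrow> poly_val y h = - int (degree h)"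
  using poly_val_infinite_place[of y h] infinite_place_val_t[of y] by (metis mult_minus1)

text \<open>
  At infinity the residue is the quotient of the leading coefficients.
\<close>

lemma residue_constant_infinite_place:
  assumes inf: "poly_val y [:0, 1:] < 0" and f: "val_ge y 0 f"
  obtains c where "val_ge y 1 (f - poly_to_ratfun [:c:])"
proof (cases "val_ge y 1 f")
  case True
  with that[of 0] show ?thesis by (simp add: poly_to_ratfun_hom)
next
  case False
  with f have f0: "f \<noteq> 0" "place_val y f = 0" by (auto simp: val_ge_def)
  obtain a b where ab: "b \<noteq> 0" "f = poly_to_ratfun a / poly_to_ratfun b" by (rule ratfun_cases)
  with f0 have a: "a \<noteq> 0" by auto
  have deg: "degree a = degree b" 
    using f0 ab a by (simp add: place_val_divide poly_val_infinity[OF inf])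
  define c where "c = lead_coeff a / lead_coeff b"
  have c0: "c \<noteq> 0" using a ab by (simp add: c_def)
  have eq: "f - poly_to_ratfun [:c:] = poly_to_ratfun (a - Polynomial.smult c b) / poly_to_ratfun b"
  proof -
    have "poly_to_ratfun (Polynomial.smult c b) = poly_to_ratfun [:c:] * poly_to_ratfun b"
      by (simp flip: poly_to_ratfun_hom)
    then show ?thesis using ab by (simp add: poly_to_ratfun_diff field_simps)
  qed
  have "val_ge y 1 (f - poly_to_ratfun [:c:])"
  proof (cases "a - Polynomial.smult c b = 0")
    case True
    with eq show ?thesis by (simp add: poly_to_ratfun_hom)
  next
    case nz: False
    have "Polynomial.coeff (a - Polynomial.smult c b) (degree b) = 0" using ab deg by (simp add: c_def)
    moreover have "degree (a - Polynomial.smult c b) \<le> degree b" using deg c0 by (intro degree_diff_le) auto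
    ultimately have "degree (a - Polynomial.smult c b) < degree b"
      using nz by (metis eq_zero_or_degree_less)
    then show ?thesis unfolding eq
      using nz ab(1) by (simp add: val_ge_def place_val_divide poly_val_infinity[OF inf])
  qed
  with that show ?thesis by blast
qed

section \<open>Residue fields and degrees\<close>

lemma carrier_local_ring: "carrier (local_ring y) = Collect (val_ge y 0)"
  by (auto simp: local_ring_def val_ge_def)

lemma local_max_ideal_eq: "local_max_ideal y = Collect (val_ge y 1)"
  by (auto simp: local_max_ideal_def val_ge_def)

lemma local_ring_simps [simp]:
  "f \<otimes>\<^bsub>local_ring y\<^esub> g = f * g" "f \<oplus>\<^bsub>local_ring y\<^esub> g = f + g"
  "\<one>\<^bsub>local_ring y\<^esub> = 1" "\<zero>\<^bsub>local_ring y\<^esub> = 0"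
  by (simp_all add: local_ring_def)

lemma local_ring_cring: "cring (local_ring y)"
proof (rule cringI)
  show "abelian_group (local_ring y)"
  proof (rule abelian_groupI)
    fix f assume "f \<in> carrier (local_ring y)"
    then show "\<exists>g\<in>carrier (local_ring y). g \<oplus>\<^bsub>local_ring y\<^esub> f = \<zero>\<^bsub>local_ring y\<^esub>"
      by (intro bexI[of _ "- f"]) (auto simp: carrier_local_ring)
  qed (auto simp: carrier_local_ring val_ge_add)
  show "comm_monoid (local_ring y)"
    by (rule comm_monoidI) (auto simp: carrier_local_ring val_ge_mult[of y 0 _ 0, simplified])
qed (auto simp: algebra_simps)

lemma local_ring_minus: "f \<in> carrier (local_ring y) \<Longrightarrow> \<ominus>\<^bsub>local_ring y\<^esub> f = - f"
proof -
  interpret cring "local_ring y" by (rule local_ring_cring)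
  show "f \<in> carrier (local_ring y) \<Longrightarrow> \<ominus>\<^bsub>local_ring y\<^esub> f = - f"
    by (rule minus_equality) (auto simp: carrier_local_ring)
qed

lemma local_max_ideal_ideal: "ideal (local_max_ideal y) (local_ring y)"
proof -
  interpret cring "local_ring y" by (rule local_ring_cring)
  show ?thesis
  proof (rule idealI)
    show "ring (local_ring y)" by (rule ring_axioms)
    show "subgroup (local_max_ideal y) (add_monoid (local_ring y))"
    proof (rule add.subgroupI)
      fix f assume "f \<in> local_max_ideal y"
      then have "f \<in> carrier (local_ring y)" "val_ge y 1 f"
        by (auto simp: carrier_local_ring local_max_ideal_eq elim: val_ge_mono)
      then show "\<ominus>\<^bsub>local_ring y\<^esub> f \<in> local_max_ideal y"
        by (simp add: local_ring_minus local_max_ideal_eq)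
    next
      show "local_max_ideal y \<noteq> {}" by (auto simp: local_max_ideal_eq intro: exI[of _ 0])
    qed (auto simp: local_max_ideal_eq carrier_local_ring val_ge_add elim: val_ge_mono)
  qed (use val_ge_mult[of y 1 _ 0] val_ge_mult[of y 0 _ 1] in
      \<open>auto simp: local_max_ideal_eq carrier_local_ring\<close>)
qed

lemma residue_field_ring: "ring (residue_field y)"
  unfolding residue_field_def by (rule ideal.quotient_is_ring[OF local_max_ideal_ideal])

lemma residue_hom: "ring_hom_ring (local_ring y) (residue_field y)
    (\<lambda>f. local_max_ideal y +>\<^bsub>local_ring y\<^esub> f)"
  unfolding residue_field_def
  by (rule ideal.rcos_ring_hom_ring[OF local_max_ideal_ideal])

lemma residue_eq_iff:
  assumes "f \<in> carrier (local_ring y)" "g \<in> carrier (local_ring y)"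
  shows "local_max_ideal y +>\<^bsub>local_ring y\<^esub> f = local_max_ideal y +>\<^bsub>local_ring y\<^esub> g
    \<longleftrightarrow> val_ge y 1 (f - g)"
proof -
  interpret cring "local_ring y" by (rule local_ring_cring)
  have "f \<ominus>\<^bsub>local_ring y\<^esub> g = f - g"
    using assms by (simp add: a_minus_def local_ring_minus)
  with quotient_eq_iff_same_a_r_cos[OF local_max_ideal_ideal assms] show ?thesis
    by (simp add: local_max_ideal_eq)
qed

lemma carrier_residue_field: "carrier (residue_field y) =
    (\<lambda>f. local_max_ideal y +>\<^bsub>local_ring y\<^esub> f) ` carrier (local_ring y)"
  unfolding residue_field_def FactRing_def by (auto simp: A_RCOSETS_def')

lemma residue_field_one_not_zero: "\<one>\<^bsub>residue_field y\<^esub> \<noteq> \<zero>\<^bsub>residue_field y\<^esub>"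
proof -
  interpret h: ring_hom_ring "local_ring y" "residue_field y"
    "\<lambda>f. local_max_ideal y +>\<^bsub>local_ring y\<^esub> f" by (rule residue_hom)
  have "local_max_ideal y +>\<^bsub>local_ring y\<^esub> 1 \<noteq> local_max_ideal y +>\<^bsub>local_ring y\<^esub> 0"
    by (subst residue_eq_iff) (auto simp: carrier_local_ring)
  with h.hom_one h.hom_zero show ?thesis by simp
qed

lemma residue_constants_subfield: "subfield (residue_constants y) (residue_field y)"
proof -
  interpret cring "local_ring y" by (rule local_ring_cring)
  define C :: "'a ratfun set" where "C = range (\<lambda>c. poly_to_ratfun [:c:])"
  have sub: "C \<subseteq> carrier (local_ring y)" by (auto simp: C_def carrier_local_ring)
  have mem: "poly_to_ratfun [:c:] \<in> C" for c by (auto simp: C_def)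
  have C1: "1 \<in> C" using mem[of 1] by (simp add: poly_to_ratfun_hom flip: one_pCons)
  have minus: "- poly_to_ratfun [:c:] = poly_to_ratfun [:- c:]" for c :: 'a
    using poly_to_ratfun_diff[of 0 "[:c:]"] by (simp add: poly_to_ratfun_hom)
  have add: "poly_to_ratfun [:c:] + poly_to_ratfun [:d:] = poly_to_ratfun [:c + d:]" for c d :: 'a
    by (simp flip: poly_to_ratfun_hom)
  have mult: "poly_to_ratfun [:c:] * poly_to_ratfun [:d:] = poly_to_ratfun [:c * d:]" for c d :: 'a
    by (simp add: mult.commute flip: poly_to_ratfun_hom)
  have subcring: "subcring C (local_ring y)"
  proof (rule subcringI)
    show "subring C (local_ring y)"
    proof (rule subringI)
      fix f assume f: "f \<in> C"
      with sub have "\<ominus>\<^bsub>local_ring y\<^esub> f = - f" by (intro local_ring_minus) auto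
      with f show "\<ominus>\<^bsub>local_ring y\<^esub> f \<in> C" by (auto simp: C_def minus)
    qed (use sub C1 in \<open>auto simp: C_def mult add\<close>)
  qed (simp add: mult.commute)
  have "subfield C (local_ring y)"
  proof (rule subfieldI[OF subcring])
    show "Units (local_ring y\<lparr>carrier := C\<rparr>) = C - {\<zero>\<^bsub>local_ring y\<^esub>}"
    proof safe
      fix f assume "f \<in> Units (local_ring y\<lparr>carrier := C\<rparr>)"
      then show "f \<in> C" by (simp add: Units_def)
    next
      assume "\<zero>\<^bsub>local_ring y\<^esub> \<in> Units (local_ring y\<lparr>carrier := C\<rparr>)"
      then show False by (auto simp: Units_def)
    next
      fix f assume f: "f \<in> C" "f \<notin> Units (local_ring y\<lparr>carrier := C\<rparr>)"
      then obtain c where c: "f = poly_to_ratfun [:c:]" by (auto simp: C_def)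
      show "f = \<zero>\<^bsub>local_ring y\<^esub>"
      proof (rule ccontr)
        assume "f \<noteq> \<zero>\<^bsub>local_ring y\<^esub>"
        with c have "c \<noteq> 0" by (auto simp: poly_to_ratfun_hom)
        then have "poly_to_ratfun [:inverse c:] * f = 1" "f * poly_to_ratfun [:inverse c:] = 1"
          unfolding c mult by (simp_all add: poly_to_ratfun_hom flip: one_pCons)
        with f mem show False by (auto simp: Units_def)
      qed
    qed
  qed
  then have "subfield ((\<lambda>f. local_max_ideal y +>\<^bsub>local_ring y\<^esub> f) ` C) (residue_field y)"
    by (rule ring_hom_ring.img_is_subfield(2)[OF residue_hom _ residue_field_one_not_zero])
  then show ?thesis by (simp add: residue_constants_def C_def image_image)
qed

lemma finite_residue_field: "finite (carrier (residue_field y))"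
proof -
  have "\<exists>N. \<forall>f. val_ge y 0 f \<longrightarrow> (\<exists>r. degree r \<le> N \<and> val_ge y 1 (f - poly_to_ratfun r))"
  proof (cases "poly_val y [:0, 1:] < 0")
    case True
    then show ?thesis
      by (intro exI[of _ 0]) (metis residue_constant_infinite_place degree_pCons_0 order_refl)
  next
    case False
    then have fin: "poly_val y [:0, 1:] \<ge> 0" by simp
    show ?thesis
      by (rule finite_place_generator[OF fin])
        (metis residue_representative_finite_place[OF fin] less_imp_le)
  qed
  then obtain N where N: "\<And>f. val_ge y 0 f \<Longrightarrow> \<exists>r. degree r \<le> N \<and> val_ge y 1 (f - poly_to_ratfun r)"
    by blast
  have "carrier (residue_field y) \<subseteq>
    (\<lambda>r. local_max_ideal y +>\<^bsub>local_ring y\<^esub> poly_to_ratfun r) ` {r. degree r \<le> N}"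
  proof
    fix X assume "X \<in> carrier (residue_field y)"
    then obtain f where f: "val_ge y 0 f" "X = local_max_ideal y +>\<^bsub>local_ring y\<^esub> f"
      by (auto simp: carrier_residue_field carrier_local_ring)
    from N[OF f(1)] obtain r where r: "degree r \<le> N" "val_ge y 1 (f - poly_to_ratfun r)" by blast
    have "val_ge y 0 (f - (f - poly_to_ratfun r))"
      by (rule val_ge_diff[OF f(1) val_ge_mono[OF r(2)]]) simp
    then have "X = local_max_ideal y +>\<^bsub>local_ring y\<^esub> poly_to_ratfun r"
      unfolding f(2) using f(1) r(2) by (subst residue_eq_iff) (auto simp: carrier_local_ring)
    with r(1) show "X \<in> (\<lambda>r. local_max_ideal y +>\<^bsub>local_ring y\<^esub> poly_to_ratfun r) ` {r. degree r \<le> N}"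
      by blast
  qed
  then show ?thesis by (rule finite_subset) (intro finite_imageI finite_polys_degree_le)
qed

text \<open>
  The degree is defined by a definite description, so finiteness of the residue field is what
  gives it its meaning.
\<close>

lemma dimension_residue_field:
  "ring.dimension (residue_field y) (place_degree y) (residue_constants y) (carrier (residue_field y))"
proof -
  interpret ring "residue_field y" by (rule residue_field_ring)
  note K = residue_constants_subfield[of y]
  obtain Us where Us: "set Us = carrier (residue_field y)"
    using finite_residue_field finite_list by blast
  then have "Span (residue_constants y) Us = carrier (residue_field y)"
    using Span_base_incl[OF K, of Us] Span_in_carrier[of "residue_constants y" Us] subfieldE(3)[OF K]
    by blast
  with Span_finite_dimension[OF K, of Us] Us
  have "finite_dimension (residue_constants y) (carrier (residue_field y))" by simp
  from finite_dimensionE[OF K this] show ?thesis by (simp add: place_degree_def over_def)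
qed

lemma place_degree_pos: "place_degree y > 0"
proof (rule ccontr)
  interpret ring "residue_field y" by (rule residue_field_ring)
  assume "\<not> place_degree y > 0"
  with dimension_residue_field[of y] have "dimension 0 (residue_constants y) (carrier (residue_field y))"
    by simp
  from dimension_zero[OF residue_constants_subfield this] residue_field_one_not_zero[of y] one_closed
  show False by (simp del: one_closed)
qed

text \<open>
  A residue field of dimension one over the constants is spanned by \<open>1\<close>. The whole argument uses
  the degree of \<open>x\<close> through this fact only.
\<close>

lemma degree_one_residue_constant:
  assumes deg: "place_degree y = 1" and f: "val_ge y 0 f"
  obtains c where "val_ge y 1 (f - poly_to_ratfun [:c:])"
proof -
  interpret ring "residue_field y" by (rule residue_field_ring)
  note K = residue_constants_subfield[of y]
  have "dimension 1 (residue_constants y) (carrier (residue_field y))"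
    using dimension_residue_field[of y] deg by simp
  moreover have "independent (residue_constants y) [\<one>\<^bsub>residue_field y\<^esub>]"
    using residue_field_one_not_zero by (intro li_Cons) auto
  ultimately have "Span (residue_constants y) [\<one>\<^bsub>residue_field y\<^esub>] = carrier (residue_field y)"
    using independent_length_eq_dimension[OF K, of 1 "carrier (residue_field y)" "[\<one>\<^bsub>residue_field y\<^esub>]"]
    by simp
  moreover have "Span (residue_constants y) [\<one>\<^bsub>residue_field y\<^esub>] \<subseteq> residue_constants y"
    using subfieldE(3)[OF K] by (auto simp: line_extension_mem_iff subset_iff)
  ultimately have "local_max_ideal y +>\<^bsub>local_ring y\<^esub> f \<in> residue_constants y"
    using f by (auto simp: carrier_residue_field carrier_local_ring)
  then obtain c where "local_max_ideal y +>\<^bsub>local_ring y\<^esub> f =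
      local_max_ideal y +>\<^bsub>local_ring y\<^esub> poly_to_ratfun [:c:]"
    by (auto simp: residue_constants_def)
  with f that show ?thesis by (subst (asm) residue_eq_iff) (auto simp: carrier_local_ring)
qed

section \<open>Rational functions with prescribed poles\<close>

text \<open>
  The equation of the closed point \<open>y\<close> in homogeneous coordinates, written in the variable \<open>t\<close>. For
  the place at infinity this is a constant, and then the condition only says that there are no
  finite zeros.
\<close>

definition place_form :: "'a::{field, finite} place \<Rightarrow> 'a poly \<Rightarrow> bool" where
  "place_form y P \<longleftrightarrow> P \<noteq> 0 \<and>
     (\<forall>z. poly_val z [:0, 1:] \<ge> 0 \<longrightarrow> poly_val z P = (if z = y then 1 else 0))"

lemma place_form_infinite_place:
  assumes "poly_val y [:0, 1:] < 0"
  shows "place_form y 1"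
  using assms by (auto simp: place_form_def poly_to_ratfun_hom place_val_1)

lemma finite_place_form:
  assumes fin: "poly_val y [:0, 1:] \<ge> 0"
  obtains P where "place_form y P" "degree P > 0"
    "\<And>h. h \<noteq> 0 \<Longrightarrow> poly_val y h > 0 \<longleftrightarrow> P dvd h"
    "\<And>h. h \<noteq> 0 \<Longrightarrow> poly_val y h = int (poly_order P h)"
proof -
  obtain P where P: "P \<noteq> 0" "degree P > 0" "poly_val y P = 1"
    "\<And>h. h \<noteq> 0 \<Longrightarrow> poly_val y h > 0 \<longleftrightarrow> P dvd h"
    "\<And>h. h \<noteq> 0 \<Longrightarrow> poly_val y h = int (poly_order P h)"
    using finite_place_generator[OF fin] by blast
  have unique: "z = y" if z: "poly_val z [:0, 1:] \<ge> 0" and pos: "poly_val z P > 0" for z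
  proof (rule place_eqI)
    fix h :: "'a poly" assume h: "h \<noteq> 0"
    obtain Q where Q: "Q \<noteq> 0" "degree Q > 0" "poly_val z Q = 1"
      "\<And>h. h \<noteq> 0 \<Longrightarrow> poly_val z h > 0 \<longleftrightarrow> Q dvd h"
      using finite_place_generator[OF z] by metis
    obtain k where k: "P = Q * k" using Q(4)[OF P(1)] pos by (auto elim: dvdE)
    with P have k0: "k \<noteq> 0" by auto
    have "\<not> P dvd k"
    proof
      assume "P dvd k"
      then have "degree P \<le> degree k" using k0 by (rule dvd_imp_degree_le)
      moreover have "degree P = degree Q + degree k" using k Q(1) k0 by (simp add: degree_mult_eq)
      ultimately show False using Q(2) by simp
    qed
    with P(4)[OF k0] have "poly_val y k \<le> 0" by simp
    moreover have "poly_val y P = poly_val y Q + poly_val y k" using k Q k0 by (simp add: poly_val_mult)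
    ultimately have "poly_val y Q > 0" using P(3) by simp
    with P(4)[OF Q(1)] have "P dvd Q" by simp
    then have deg: "degree P \<le> degree Q" using Q(1) by (rule dvd_imp_degree_le)
    \<comment> \<open>So \<open>P\<close> has least degree among the polynomials that vanish at \<open>z\<close>, and this determines \<open>z\<close>.\<close>
    have "poly_val z h = int (poly_order P h)"
    proof (rule poly_val_finite_place[OF z P(1) pos _ h])
      fix g :: "'a poly" assume "g \<noteq> 0" "poly_val z g > 0"
      with Q(4)[of g] deg show "degree P \<le> degree g" by (meson dvd_imp_degree_le order_trans)
    qed
    with P(5)[OF h] show "poly_val z h = poly_val y h" by simp
  qed
  have "poly_val z P = (if z = y then 1 else 0)" if z: "poly_val z [:0, 1:] \<ge> 0" for z
    using unique[OF z] P(3) poly_val_finite_place_nonneg[OF z P(1)] by (cases "z = y") force+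
  then have "place_form y P"
    unfolding place_form_def using P(1) by blast
  with that P show ?thesis by blast
qed

text \<open>
  If the residue of \<open>t\<close> is the constant \<open>c\<close>, then \<open>t - c\<close> vanishes at \<open>x\<close>.
\<close>

lemma degree_one_place_form:
  assumes deg: "place_degree x = 1"
  obtains P where "place_form x P" "poly_val x [:0, 1:] \<ge> 0 \<Longrightarrow> degree P = 1"
    "poly_val x [:0, 1:] < 0 \<Longrightarrow> P = 1"
proof (cases "poly_val x [:0, 1:] < 0")
  case True
  with that[of 1] place_form_infinite_place show ?thesis by auto
next
  case False
  then have fin: "poly_val x [:0, 1:] \<ge> 0" by simp
  obtain P where P: "place_form x P" "degree P > 0"
    "\<And>h. h \<noteq> 0 \<Longrightarrow> poly_val x h > 0 \<longleftrightarrow> P dvd h"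
    using finite_place_form[OF fin] by metis
  have "val_ge x 0 (poly_to_ratfun [:0, 1:])" using fin by (simp add: val_ge_def)
  from degree_one_residue_constant[OF deg this]
  obtain c where "val_ge x 1 (poly_to_ratfun [:0, 1:] - poly_to_ratfun [:c:])" .
  then have "val_ge x 1 (poly_to_ratfun [:- c, 1:])" by (simp flip: poly_to_ratfun_diff)
  then have "P dvd [:- c, 1:]" using P(3)[of "[:- c, 1:]"] by (simp add: val_ge_def)
  then have "degree P \<le> degree [:- c, 1:]" by (rule dvd_imp_degree_le) simp
  with P(2) have "degree P = 1" by simp
  with P(1) that False show ?thesis by simp
qed

lemma place_val_power_int_divide:
  assumes "f \<noteq> 0" "g \<noteq> 0"
  shows "place_val y (f / g ^ n) = place_val y f - int n * place_val y g"
  using assms by (simp add: place_val_divide place_val_power)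

text \<open>
  The divisor \<open>y - deg(y) x\<close> has degree zero, so on the projective line it is principal.
\<close>

lemma ex_uniformizer_unit_elsewhere:
  assumes deg: "place_degree x = 1" and "y \<noteq> x"
  obtains \<pi> where "\<pi> \<noteq> 0" "\<And>z. z \<noteq> x \<Longrightarrow> place_val z \<pi> = (if z = y then 1 else 0)"
proof -
  obtain P where P: "place_form x P" "poly_val x [:0, 1:] \<ge> 0 \<Longrightarrow> degree P = 1"
    using degree_one_place_form[OF deg] by metis
  have P0: "P \<noteq> 0" using P by (simp add: place_form_def)
  have "\<exists>Q n. place_form y Q \<and> n = (if poly_val y [:0, 1:] < 0 then degree Q + 1 else degree Q)
      \<and> (poly_val y [:0, 1:] < 0 \<longrightarrow> degree Q = 0)"
  proof (cases "poly_val y [:0, 1:] < 0")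
    case True
    with place_form_infinite_place[OF True] show ?thesis by (intro exI[of _ 1]) auto
  next
    case False
    then have "poly_val y [:0, 1:] \<ge> 0" by simp
    with finite_place_form[OF this] False show ?thesis by metis
  qed
  then obtain Q n where Q: "place_form y Q" "n = (if poly_val y [:0, 1:] < 0 then degree Q + 1 else degree Q)"
    "poly_val y [:0, 1:] < 0 \<Longrightarrow> degree Q = 0" by blast
  have Q0: "Q \<noteq> 0" using Q by (simp add: place_form_def)
  define \<pi> where "\<pi> = poly_to_ratfun Q / poly_to_ratfun P ^ n"
  have "place_val z \<pi> = (if z = y then 1 else 0)" if z: "z \<noteq> x" for z
  proof -
    have v: "place_val z \<pi> = poly_val z Q - int n * poly_val z P"
      unfolding \<pi>_def using P0 Q0 by (intro place_val_power_int_divide) auto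
    show ?thesis
    proof (cases "poly_val z [:0, 1:] < 0")
      case True
      then have "poly_val x [:0, 1:] \<ge> 0"
        using infinite_place_unique z by (metis not_le)
      then have "place_val z \<pi> = int n - int (degree Q)"
        using P(2) Q0 P0 by (simp add: v poly_val_infinity[OF True])
      moreover have "z = y \<longleftrightarrow> poly_val y [:0, 1:] < 0"
        using infinite_place_unique True by blast
      ultimately show ?thesis using Q(2) by simp
    next
      case False
      with P(1) Q(1) z show ?thesis by (simp add: v place_form_def)
    qed
  qed
  with that[of \<pi>] P0 Q0 show ?thesis by (simp add: \<pi>_def)
qed

text \<open>
  The function \<open>\<sigma>\<close> is a coordinate in which \<open>x\<close> becomes the point at infinity.
\<close>

lemma ex_simple_pole_only_at:
  assumes deg: "place_degree x = 1"
  obtains \<sigma> where "\<sigma> \<noteq> 0" "place_val x \<sigma> = - 1" "\<And>z. z \<noteq> x \<Longrightarrow> val_ge z 0 \<sigma>"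
proof (cases "poly_val x [:0, 1:] < 0")
  case True
  show ?thesis
  proof (rule that)
    show "poly_val x [:0, 1:] = - 1" by (rule infinite_place_val_t[OF True])
    show "val_ge z 0 (poly_to_ratfun [:0, 1:])" if "z \<noteq> x" for z
      using infinite_place_unique[OF True] that by (force simp: val_ge_def)
  qed simp
next
  case False
  then obtain P where P: "place_form x P" "degree P = 1"
    using degree_one_place_form[OF deg] by (metis not_le)
  then have P0: "P \<noteq> 0" by auto
  show ?thesis
  proof (rule that)
    show "inverse (poly_to_ratfun P) \<noteq> 0" using P0 by simp
    show "place_val x (inverse (poly_to_ratfun P)) = - 1"
      using P False by (simp add: place_val_inverse place_form_def)
    show "val_ge z 0 (inverse (poly_to_ratfun P))" if "z \<noteq> x" for z
    proof (cases "poly_val z [:0, 1:] < 0")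
      case True
      then show ?thesis using P P0 by (simp add: val_ge_def place_val_inverse poly_val_infinity)
    next
      case False
      with P that show ?thesis by (simp add: val_ge_def place_val_inverse place_form_def)
    qed
  qed
qed

text \<open>
  The functions that are regular outside \<open>x\<close> represent all residues at every other place: solve the
  congruence for the numerator over a power of the equation of \<open>x\<close>.
\<close>

lemma residue_representative_away_from:
  assumes deg: "place_degree x = 1" and "y \<noteq> x" and f: "val_ge y 0 f"
  obtains r where "val_ge y 1 (f - r)" "\<And>z. z \<noteq> x \<Longrightarrow> val_ge z 0 r"
proof (cases "poly_val y [:0, 1:] < 0")
  case True
  obtain c where "val_ge y 1 (f - poly_to_ratfun [:c:])"
    using residue_constant_infinite_place[OF True f] .
  from that[OF this val_ge_const] show ?thesis .
next
  case False
  then have fin: "poly_val y [:0, 1:] \<ge> 0" by simp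
  obtain Q where Q: "place_form y Q" "degree Q > 0"
    "\<And>h. h \<noteq> 0 \<Longrightarrow> poly_val y h > 0 \<longleftrightarrow> Q dvd h"
    "\<And>h. h \<noteq> 0 \<Longrightarrow> poly_val y h = int (poly_order Q h)"
    using finite_place_form[OF fin] by blast
  obtain P where P: "place_form x P" "poly_val x [:0, 1:] \<ge> 0 \<Longrightarrow> degree P = 1"
    using degree_one_place_form[OF deg] by metis
  have P0: "P \<noteq> 0" and Q0: "Q \<noteq> 0" using P Q by (auto simp: place_form_def)
  \<comment> \<open>The denominator must be a power of the equation of \<open>x\<close>; its exponent is large enough to cancel
    the pole of the numerator at infinity.\<close>
  define D where "D = poly_to_ratfun P ^ degree Q"
  have D0: "D \<noteq> 0" using P0 by (simp add: D_def)
  have D: "place_val z D = int (degree Q) * poly_val z P" for z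
    using P0 by (simp add: D_def place_val_power)
  have Dy: "place_val y D = 0" using P(1) fin assms(2) by (simp add: D place_form_def)
  have "val_ge y 0 (f * D)" using f Dy D0 by (cases "f = 0") (auto simp: val_ge_def place_val_mult)
  from residue_representative_finite_place[OF fin Q0 Q(2) _ Q(3,4) this]
  obtain r where r: "degree r < degree Q" "val_ge y 1 (f * D - poly_to_ratfun r)"
    using Q(1) fin by (auto simp: place_form_def)
  have "val_ge y (1 + 0) ((f * D - poly_to_ratfun r) * inverse D)"
    using r(2) by (rule val_ge_mult) (simp add: val_ge_def place_val_inverse Dy)
  moreover have "(f * D - poly_to_ratfun r) * inverse D = f - poly_to_ratfun r / D"
    using D0 by (simp add: field_simps)
  ultimately have "val_ge y 1 (f - poly_to_ratfun r / D)" by simp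
  moreover have "val_ge z 0 (poly_to_ratfun r / D)" if z: "z \<noteq> x" for z
  proof (cases "r = 0")
    case r0: False
    have v: "place_val z (poly_to_ratfun r / D) = poly_val z r - int (degree Q) * poly_val z P"
      using r0 D0 by (simp add: place_val_divide D)
    show ?thesis
    proof (cases "poly_val z [:0, 1:] < 0")
      case True
      then have "poly_val x [:0, 1:] \<ge> 0"
        using infinite_place_unique z by (metis not_le)
      with P r0 r(1) P0 show ?thesis by (simp add: val_ge_def v poly_val_infinity[OF True])
    next
      case False
      with P z poly_val_finite_place_nonneg[of z r] r0 show ?thesis
        by (simp add: val_ge_def v place_form_def)
    qed
  qed (simp add: poly_to_ratfun_hom)
  ultimately show ?thesis using that by blast
qed

text \<open>
  Subtracting a multiple of \<open>\<sigma>\<^sup>N\<close> lowers a pole of order \<open>N\<close>; this is division with remainder,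
  carried out one coefficient at a time.
\<close>

lemma approximate_at_place:
  assumes \<sigma>: "\<sigma> \<noteq> 0" "place_val y \<sigma> = - 1" "\<And>z. z \<in> Z \<Longrightarrow> val_ge z 0 \<sigma>"
    and residues: "\<And>f. val_ge y 0 f \<Longrightarrow> \<exists>r. val_ge y 1 (f - r) \<and> (\<forall>z\<in>Z. val_ge z 0 r)"
  shows "\<exists>f. val_ge y 1 (h - f) \<and> (\<forall>z\<in>Z. val_ge z 0 f)"
proof -
  have power: "val_ge z 0 (\<sigma> ^ N)" if "z \<in> Z" for z N
    using \<sigma>(3)[OF that] \<sigma>(1) by (simp add: val_ge_def place_val_power)
  have "\<exists>f. val_ge y 1 (h - f) \<and> (\<forall>z\<in>Z. val_ge z 0 f)" if "val_ge y (- int N) h" for N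
    using that
  proof (induction N arbitrary: h)
    case 0
    then show ?case using residues by simp
  next
    case (Suc N)
    have inv: "val_ge y (int (Suc N)) (inverse (\<sigma> ^ Suc N))"
      using \<sigma> by (simp add: val_ge_def place_val_inverse place_val_power del: power_Suc)
    have "val_ge y 0 (h * inverse (\<sigma> ^ Suc N))" using val_ge_mult[OF Suc.prems inv] by simp
    from residues[OF this] obtain r where
      r: "val_ge y 1 (h * inverse (\<sigma> ^ Suc N) - r)" "\<forall>z\<in>Z. val_ge z 0 r" by blast
    have "val_ge y (- int (Suc N)) (\<sigma> ^ Suc N)"
      using \<sigma> by (simp add: val_ge_def place_val_power del: power_Suc)
    from val_ge_mult[OF r(1) this]
    have "val_ge y (- int N) ((h * inverse (\<sigma> ^ Suc N) - r) * \<sigma> ^ Suc N)" by simp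
    also have "(h * inverse (\<sigma> ^ Suc N) - r) * \<sigma> ^ Suc N = h - r * \<sigma> ^ Suc N"
      using \<sigma>(1) by (simp only: left_diff_distrib mult.assoc left_inverse power_not_zero mult_1_right not_False_eq_True)
    finally obtain f where f: "val_ge y 1 (h - r * \<sigma> ^ Suc N - f)" "\<forall>z\<in>Z. val_ge z 0 f"
      using Suc.IH by blast
    have "val_ge z 0 (r * \<sigma> ^ Suc N + f)" if "z \<in> Z" for z
      using val_ge_add[OF val_ge_mult[of z 0 r 0 "\<sigma> ^ Suc N"], of f] r(2) f(2) power[OF that] that
      by (simp only: add_0_left)
    moreover have "h - (r * \<sigma> ^ Suc N + f) = h - r * \<sigma> ^ Suc N - f" by (simp only: diff_diff_eq)
    ultimately show ?case using f(1) by metis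
  qed
  from this[of "nat (- place_val y h)"] show ?thesis by (auto simp: val_ge_def)
qed

text \<open>
  The terms of a partial fraction decomposition: a function with the principal part of \<open>h\<close> at \<open>y\<close>
  that has no other pole, except possibly at \<open>x\<close>.
\<close>

lemma ex_principal_part:
  assumes deg: "place_degree x = 1"
  obtains f where "val_ge y 1 (h - f)" "\<And>z. z \<noteq> x \<Longrightarrow> z \<noteq> y \<Longrightarrow> val_ge z 0 f"
proof -
  have "\<exists>f. val_ge y 1 (h - f) \<and> (\<forall>z\<in>- {x, y}. val_ge z 0 f)"
  proof (cases "y = x")
    case True
    obtain \<sigma> where \<sigma>: "\<sigma> \<noteq> 0" "place_val x \<sigma> = - 1" "\<And>z. z \<noteq> x \<Longrightarrow> val_ge z 0 \<sigma>"
      using ex_simple_pole_only_at[OF deg] by blast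
    show ?thesis
    proof (rule approximate_at_place)
      fix f assume "val_ge y 0 f"
      then show "\<exists>r. val_ge y 1 (f - r) \<and> (\<forall>z\<in>- {x, y}. val_ge z 0 r)"
        using degree_one_residue_constant[OF deg] True by (metis val_ge_const)
    qed (use \<sigma> True in auto)
  next
    case False
    obtain \<pi> where \<pi>: "\<pi> \<noteq> 0" "\<And>z. z \<noteq> x \<Longrightarrow> place_val z \<pi> = (if z = y then 1 else 0)"
      using ex_uniformizer_unit_elsewhere[OF deg False] by blast
    show ?thesis
    proof (rule approximate_at_place[where \<sigma> = "inverse \<pi>"])
      fix f assume "val_ge y 0 f"
      then show "\<exists>r. val_ge y 1 (f - r) \<and> (\<forall>z\<in>- {x, y}. val_ge z 0 r)"
        using residue_representative_away_from[OF deg False] by (metis ComplD insertI1)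
    qed (use \<pi> False in \<open>auto simp: place_val_inverse val_ge_def\<close>)
  qed
  with that show ?thesis by auto
qed

section \<open>Absolute values\<close>

lemma card_field_gt_1: "real CARD('a::{field, finite}) > 1"
proof -
  have "card {0, 1 :: 'a} \<le> CARD('a)" by (rule card_mono) auto
  then show ?thesis by simp
qed

lemma card_power_degree_gt_1: "real CARD('a) ^ place_degree (y :: 'a::{field, finite} place) > 1"
  using card_field_gt_1 place_degree_pos by (rule one_less_power)

lemma place_abs_eq_powr:
  assumes "f \<noteq> 0"
  shows "place_abs y f = (real CARD('a) ^ place_degree y) powr (- of_int (place_val y (f :: 'a::{field, finite} ratfun)))"
  using assms by (simp add: place_abs_def powr_powr flip: powr_realpow)

lemma place_abs_le_1_iff: "place_abs y f \<le> 1 \<longleftrightarrow> val_ge y 0 f"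
  using powr_le_cancel_iff[OF card_power_degree_gt_1, of y "- of_int (place_val y f)" 0]
    card_power_degree_gt_1[of y] 
  by (cases "f = 0") (simp_all add: val_ge_def place_abs_eq_powr)

lemma place_abs_less_1_iff: "place_abs y f < 1 \<longleftrightarrow> val_ge y 1 f"
  using powr_less_cancel_iff[OF card_power_degree_gt_1, of y "- of_int (place_val y f)" 0]
    card_power_degree_gt_1[of y] 
  by (cases "f = 0") (auto simp: val_ge_def place_abs_eq_powr)

lemma place_abs_eq_0_iff [simp]: "place_abs y f = 0 \<longleftrightarrow> f = 0"
  by (simp add: place_abs_def)

lemma place_abs_inverse: "place_abs y (inverse f) = inverse (place_abs y f)"
proof (cases "f = 0")
  case False
  then have "place_abs y f * place_abs y (inverse f) = 1" by (simp flip: place_abs_mult)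
  then show ?thesis using False by (simp add: field_simps)
qed simp

lemma place_abs_eq_1_iff: "place_abs y f = 1 \<longleftrightarrow> f \<noteq> 0 \<and> place_val y f = 0"
  using place_abs_le_1_iff[of y f] place_abs_less_1_iff[of y f] by (auto simp: val_ge_def)

section \<open>Adeles and their local absolute values\<close>

lemma adele_abs_nonneg [simp]: "adele_abs y a \<ge> 0"
  by transfer (auto simp: adele_rel_def adele_family_def intro: completion_abs_nonneg)

lemma adele_abs_mult: "adele_abs y (a * b) = adele_abs y a * adele_abs y b"
  by transfer (auto simp: adele_rel_def adele_family_def intro: completion_abs_mult)

lemma adele_abs_add: "adele_abs y (a + b) \<le> max (adele_abs y a) (adele_abs y b)"
  by transfer (auto simp: adele_rel_def adele_family_def intro: completion_abs_add)

lemma adele_abs_minus [simp]: "adele_abs y (- a) = adele_abs y a"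
  by transfer simp

lemma adele_abs_0 [simp]: "adele_abs y 0 = 0"
  by transfer simp

lemma adele_abs_1 [simp]: "adele_abs y 1 = 1"
  by transfer simp

lemma adele_abs_principal [simp]: "adele_abs y (principal_adele f) = place_abs y f"
  by (simp add: principal_adele_def adele_abs.abs_eq adele_rel_refl adele_family_const)

lemma adele_abs_diff: "adele_abs y (a - b) \<le> max (adele_abs y a) (adele_abs y b)"
  using adele_abs_add[of y a "- b"] by simp

lemma adele_abs_add_le: "adele_abs y a \<le> r \<Longrightarrow> adele_abs y b \<le> r \<Longrightarrow> adele_abs y (a + b) \<le> r"
  using adele_abs_add[of y a b] by simp

lemma adele_abs_add_less: "adele_abs y a < r \<Longrightarrow> adele_abs y b < r \<Longrightarrow> adele_abs y (a + b) < r"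
  using adele_abs_add[of y a b] by simp

lemma adele_abs_eq_if_close:
  assumes "adele_abs y (a - b) < adele_abs y a"
  shows "adele_abs y b = adele_abs y a"
  using assms adele_abs_add[of y "a - b" b] adele_abs_diff[of y a "a - b"] by (auto simp: max_def split: if_splits)

lemma adele_eqI:
  assumes "\<And>y. adele_abs y (a - b) = 0"
  shows "a = b"
proof -
  have "\<forall>y. adele_abs y (a + - b) = 0" using assms by simp
  then show ?thesis
  proof transfer
    fix \<alpha> \<beta> :: "'a place \<Rightarrow> nat \<Rightarrow> 'a ratfun"
    assume \<alpha>: "adele_rel \<alpha> \<alpha>" and \<beta>: "adele_rel \<beta> \<beta>"
      and 0: "\<forall>y. completion_abs y (\<lambda>n. \<alpha> y n + - \<beta> y n) = 0"
    have fam: "adele_family (\<lambda>y n. \<alpha> y n + - \<beta> y n)"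
      using \<alpha> \<beta> by (intro adele_family_add adele_family_minus) (auto simp: adele_rel_def)
    have "place_null y (\<lambda>n. \<alpha> y n - \<beta> y n)" for y
    proof -
      have "place_Cauchy y (\<lambda>n. \<alpha> y n + - \<beta> y n)" using fam by (simp add: adele_family_def)
      from place_Cauchy_convergent[OF this] 0 show ?thesis by (simp add: place_null_def)
    qed
    with \<alpha> \<beta> show "adele_rel \<alpha> \<beta>" by (simp add: adele_rel_def)
  qed
qed

lemma finite_adele_poles: "finite {y. adele_abs y a > 1}"
  by transfer (auto simp: adele_rel_def adele_family_def not_le)

lemma approximate_adele_at_place:
  assumes "e > 0"
  shows "\<exists>f. adele_abs y (a - principal_adele f) < e"
proof -
  have "\<exists>f. adele_abs y (a + principal_adele (- f)) < e"
  proof (induction a rule: adele.abs_induct)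
    fix \<alpha> :: "'a place \<Rightarrow> nat \<Rightarrow> 'a ratfun"
    assume \<alpha>: "adele_rel \<alpha> \<alpha>"
    have c: "place_Cauchy y (\<alpha> y)" using \<alpha> by (simp add: adele_rel_def adele_family_def)
    have "e / 2 > 0" using assms by simp
    with c obtain M where
      M: "\<And>m n. m \<ge> M \<Longrightarrow> n \<ge> M \<Longrightarrow> place_abs y (\<alpha> y m - \<alpha> y n) < e / 2"
      unfolding place_Cauchy_def by blast
    have "place_Cauchy y (\<lambda>n. \<alpha> y n + - \<alpha> y M)"
      using c by (intro place_Cauchy_add place_Cauchy_const)
    from place_Cauchy_convergent[OF this]
    have "completion_abs y (\<lambda>n. \<alpha> y n + - \<alpha> y M) \<le> e / 2"
      by (rule LIMSEQ_le_const2) (use M in \<open>auto intro!: exI[of _ M] less_imp_le\<close>)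
    moreover have const: "adele_rel (\<lambda>y n. - \<alpha> z M) (\<lambda>y n. - \<alpha> z M)" for z
      by (rule adele_rel_refl[OF adele_family_const])
    ultimately have "adele_abs y (abs_adele \<alpha> + principal_adele (- \<alpha> y M)) < e"
      using assms unfolding principal_adele_def plus_adele.abs_eq[OF \<alpha> const]
        adele_abs.abs_eq[OF adele_rel_add[OF \<alpha> const]] by linarith
    then show "\<exists>f. adele_abs y (abs_adele \<alpha> + principal_adele (- f)) < e" by blast
  qed
  then show ?thesis by (simp add: principal_adele_minus)
qed

text \<open>
  By density of \<open>F\<close> and the ultrametric inequality, completion does not enlarge the value group.
\<close>

lemma ex_place_abs_eq_adele_abs:
  assumes "adele_abs y a \<noteq> 0"
  obtains f where "f \<noteq> 0" "place_abs y f = adele_abs y a"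
proof -
  have "adele_abs y a > 0" using assms adele_abs_nonneg[of y a] by linarith
  from approximate_adele_at_place[OF this] obtain f
    where f: "adele_abs y (a - principal_adele f) < adele_abs y a" by blast
  have "place_abs y f = adele_abs y a" using adele_abs_eq_if_close[OF f] by simp
  with assms have "f \<noteq> 0" by auto
  from that[OF this \<open>place_abs y f = adele_abs y a\<close>] show ?thesis .
qed

lemma adele_unit_abs:
  assumes "a * b = 1"
  shows "adele_abs y a \<noteq> 0" "adele_abs y b = inverse (adele_abs y a)" "finite {y. adele_abs y a \<noteq> 1}"
proof -
  have ab: "adele_abs y a * adele_abs y b = 1" for y
    using arg_cong[OF assms, of "adele_abs y"] by (simp add: adele_abs_mult)
  show "adele_abs y a \<noteq> 0" using ab[of y] by auto
  show inv: "adele_abs y b = inverse (adele_abs y a)" for y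
    using ab[of y] by (simp add: field_simps) (auto simp: divide_simps mult.commute)
  have "{y. adele_abs y a \<noteq> 1} \<subseteq> {y. adele_abs y a > 1} \<union> {y. adele_abs y b > 1}"
  proof
    fix y assume "y \<in> {y. adele_abs y a \<noteq> 1}"
    moreover have "adele_abs y b > 1" if "adele_abs y a < 1"
      using that ab[of y] adele_abs_nonneg[of y a] inv[of y] by (metis less_eq_real_def mult_zero_left one_less_inverse zero_neq_one)
    ultimately show "y \<in> {y. adele_abs y a > 1} \<union> {y. adele_abs y b > 1}" by fastforce
  qed
  then show "finite {y. adele_abs y a \<noteq> 1}"
    by (rule finite_subset) (intro finite_UnI finite_adele_poles)
qed

text \<open>
  Invertibility is a local condition because a Cauchy sequence that does not tend to zero has
  eventually constant absolute value, so its termwise inverse is again Cauchy.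
\<close>

lemma adele_unitI:
  assumes "\<And>y. adele_abs y a \<noteq> 0" "finite {y. adele_abs y a \<noteq> 1}"
  shows "\<exists>b. a * b = 1"
proof -
  have "\<forall>y. adele_abs y a \<noteq> 0" using assms(1) by simp
  then show ?thesis using assms(2)
  proof transfer
    fix \<alpha> :: "'a place \<Rightarrow> nat \<Rightarrow> 'a ratfun"
    assume \<alpha>: "adele_rel \<alpha> \<alpha>" and nz: "\<forall>y. completion_abs y (\<alpha> y) \<noteq> 0"
      and fin: "finite {y. completion_abs y (\<alpha> y) \<noteq> 1}"
    define \<beta> where "\<beta> y n = inverse (\<alpha> y n)" for y n
    have c: "place_Cauchy y (\<alpha> y)" for y using \<alpha> by (simp add: adele_rel_def adele_family_def)
    have lim: "(\<lambda>n. place_abs y (\<alpha> y n)) \<longlonglongrightarrow> completion_abs y (\<alpha> y)" for y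
      by (rule place_Cauchy_convergent[OF c])
    have pos: "completion_abs y (\<alpha> y) > 0" for y
      using nz completion_abs_nonneg[OF c[of y]] by (simp add: order_less_le)
    have \<beta>lim: "(\<lambda>n. place_abs y (\<beta> y n)) \<longlonglongrightarrow> inverse (completion_abs y (\<alpha> y))" for y
      unfolding \<beta>_def place_abs_inverse using nz by (intro tendsto_inverse lim) simp
    have \<beta>c: "place_Cauchy y (\<beta> y)" for y
      unfolding place_Cauchy_def
    proof (intro allI impI)
      fix e :: real assume e: "e > 0"
      define c0 where "c0 = completion_abs y (\<alpha> y) / 2"
      have c0: "c0 > 0" using pos[of y] by (simp add: c0_def)
      have "eventually (\<lambda>n. place_abs y (\<alpha> y n) > c0) sequentially"
        using lim[of y] pos[of y] by (intro order_tendstoD(1)) (auto simp: c0_def)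
      then obtain N where N: "\<And>n. n \<ge> N \<Longrightarrow> place_abs y (\<alpha> y n) > c0"
        unfolding eventually_sequentially by blast
      have "e * (c0 * c0) > 0" using e c0 by simp
      then obtain M where M: "\<And>m n. m \<ge> M \<Longrightarrow> n \<ge> M \<Longrightarrow> place_abs y (\<alpha> y m - \<alpha> y n) < e * (c0 * c0)"
        using c[of y] unfolding place_Cauchy_def by blast
      have "place_abs y (\<beta> y m - \<beta> y n) < e" if "m \<ge> max M N" "n \<ge> max M N" for m n
      proof -
        have gt: "place_abs y (\<alpha> y m) > c0" "place_abs y (\<alpha> y n) > c0" using that N by auto
        then have 0: "\<alpha> y m \<noteq> 0" "\<alpha> y n \<noteq> 0" using c0 by auto
        then have "\<alpha> y n - \<alpha> y m = (\<beta> y m - \<beta> y n) * (\<alpha> y m * \<alpha> y n)"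
          by (simp add: \<beta>_def field_simps)
        then have "place_abs y (\<beta> y m - \<beta> y n) * (place_abs y (\<alpha> y m) * place_abs y (\<alpha> y n))
            = place_abs y (\<alpha> y n - \<alpha> y m)"
          by (simp only: place_abs_mult)
        also have "\<dots> < e * (c0 * c0)" using that by (intro M) auto
        also have "\<dots> \<le> e * (place_abs y (\<alpha> y m) * place_abs y (\<alpha> y n))"
          using gt c0 e by (intro mult_left_mono mult_mono) auto
        finally show ?thesis by (rule mult_right_less_imp_less) simp
      qed
      then show "\<exists>M. \<forall>m\<ge>M. \<forall>n\<ge>M. place_abs y (\<beta> y m - \<beta> y n) < e" by blast
    qed
    have \<beta>abs: "completion_abs y (\<beta> y) = inverse (completion_abs y (\<alpha> y))" for y
      by (rule LIMSEQ_unique[OF place_Cauchy_convergent[OF \<beta>c] \<beta>lim])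
    have "{y. \<not> completion_abs y (\<beta> y) \<le> 1} \<subseteq> {y. completion_abs y (\<alpha> y) \<noteq> 1}"
      by (auto simp: \<beta>abs)
    with fin have fam: "adele_family \<beta>"
      using \<beta>c by (auto simp: adele_family_def intro: finite_subset)
    have "place_null y (\<lambda>n. \<alpha> y n * \<beta> y n - 1)" for y
    proof -
      have "eventually (\<lambda>n. place_abs y (\<alpha> y n) > 0) sequentially"
        using lim[of y] pos[of y] by (intro order_tendstoD(1))
      then have "eventually (\<lambda>n. place_abs y (\<alpha> y n * \<beta> y n - 1) = 0) sequentially"
      proof eventually_elim
        case (elim n)
        then have "\<alpha> y n \<noteq> 0" by auto
        then show ?case by (simp add: \<beta>_def)
      qed
      then show ?thesis unfolding place_null_def by (rule tendsto_eventually)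
    qed
    then have "adele_rel (\<lambda>y n. \<alpha> y n * \<beta> y n) (\<lambda>y n. 1)"
      using \<alpha> fam by (intro adele_relI adele_family_mult adele_family_const) (auto simp: adele_rel_def)
    with fam adele_rel_refl show "\<exists>\<beta>\<in>{\<beta>. adele_rel \<beta> \<beta>}. adele_rel (\<lambda>y n. \<alpha> y n * \<beta> y n) (\<lambda>y n. 1)"
      by blast
  qed
qed

text \<open>
  The idempotent of a set of places; it is used to make different choices at different places.
\<close>

lift_definition place_indicator :: "'a::{field, finite} place set \<Rightarrow> 'a adele" is
  "\<lambda>S y n. if y \<in> S then 1 else 0"
proof (rule adele_rel_refl)
  fix S :: "'a place set"
  show "adele_family (\<lambda>y (n::nat). if y \<in> S then 1 else 0 :: 'a ratfun)"
    by (auto simp: adele_family_def place_Cauchy_const)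
qed

lemma adele_abs_glue:
  "adele_abs y (place_indicator S * a + (1 - place_indicator S) * b) =
    (if y \<in> S then adele_abs y a else adele_abs y b)"
proof -
  have "adele_abs y (place_indicator S * a + (1 + - place_indicator S) * b) =
    (if y \<in> S then adele_abs y a else adele_abs y b)"
    by transfer auto
  then show ?thesis by simp
qed

lemma place_indicator_idem: "place_indicator S * place_indicator S = place_indicator S"
proof (rule adele_eqI)
  fix y
  have "adele_abs y (place_indicator S * place_indicator S + - place_indicator S) = 0"
    by transfer auto
  then show "adele_abs y (place_indicator S * place_indicator S - place_indicator S) = 0" by simp
qed

section \<open>Strong approximation and class number one\<close>

text \<open>
  The vanishing of \<open>H\<^sup>1(\<bbbP>\<^sup>1, O(-x))\<close>, by partial fractions: the principal parts at the places
  other than \<open>x\<close> do not disturb each other, and the one at \<open>x\<close> is removed last.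
\<close>

lemma strong_approximation:
  assumes deg: "place_degree x = 1"
  obtains f where "\<And>y. y \<noteq> x \<Longrightarrow> adele_abs y (a - principal_adele f) \<le> 1"
    "adele_abs x (a - principal_adele f) < 1"
proof -
  have principal: "\<exists>f. adele_abs y (b - principal_adele f) < 1 \<and>
      (\<forall>z. z \<noteq> x \<longrightarrow> z \<noteq> y \<longrightarrow> place_abs z f \<le> 1)" for y b
  proof -
    obtain h where h: "adele_abs y (b - principal_adele h) < 1"
      using approximate_adele_at_place[of 1 y b] by auto
    obtain f where f: "val_ge y 1 (h - f)" "\<And>z. z \<noteq> x \<Longrightarrow> z \<noteq> y \<Longrightarrow> val_ge z 0 f"
      using ex_principal_part[OF deg] by blast
    have "b - principal_adele f = (b - principal_adele h) + principal_adele (h - f)"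
      using principal_adele_add[of "h - f" f] by (simp add: algebra_simps)
    also have "adele_abs y \<dots> < 1"
      using h f(1) by (intro adele_abs_add_less) (simp_all add: place_abs_less_1_iff)
    finally have "adele_abs y (b - principal_adele f) < 1" .
    with f(2) show ?thesis by (auto simp: place_abs_le_1_iff)
  qed
  define S where "S = {y. adele_abs y a > 1} - {x}"
  have "finite S" using finite_adele_poles[of a] by (simp add: S_def)
  then have "\<exists>f. \<forall>y. y \<noteq> x \<longrightarrow> (y \<in> S \<longrightarrow> adele_abs y (a - principal_adele f) \<le> 1) \<and>
      (y \<notin> S \<longrightarrow> place_abs y f \<le> 1)"
  proof (induction S rule: finite_induct)
    case empty
    show ?case by (intro exI[of _ 0]) simp
  next
    case (insert z S)
    then obtain f where f: "\<And>y. y \<noteq> x \<Longrightarrow> y \<in> S \<Longrightarrow> adele_abs y (a - principal_adele f) \<le> 1"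
      "\<And>y. y \<noteq> x \<Longrightarrow> y \<notin> S \<Longrightarrow> place_abs y f \<le> 1" by blast
    obtain g where g: "adele_abs z (a - principal_adele f - principal_adele g) < 1"
      "\<And>y. y \<noteq> x \<Longrightarrow> y \<noteq> z \<Longrightarrow> place_abs y g \<le> 1" using principal by blast
    have diff: "a - principal_adele (f + g) = a - principal_adele f + - principal_adele g"
      by (simp add: principal_adele_add)
    show ?case
    proof (intro exI[of _ "f + g"] allI impI conjI)
      fix y assume y: "y \<noteq> x" "y \<in> insert z S"
      show "adele_abs y (a - principal_adele (f + g)) \<le> 1"
      proof (cases "y = z")
        case True
        with g(1) show ?thesis by (simp add: diff)
      next
        case False
        with y f(1) g(2) show ?thesis unfolding diff by (intro adele_abs_add_le) auto
      qed
    next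
      fix y assume y: "y \<noteq> x" "y \<notin> insert z S"
      with f(2)[of y] g(2)[of y] place_abs_add[of y f g] show "place_abs y (f + g) \<le> 1" by auto
    qed
  qed
  then obtain f where f: "\<And>y. y \<noteq> x \<Longrightarrow> y \<in> S \<Longrightarrow> adele_abs y (a - principal_adele f) \<le> 1"
    "\<And>y. y \<noteq> x \<Longrightarrow> y \<notin> S \<Longrightarrow> place_abs y f \<le> 1" by blast
  have f': "adele_abs y (a - principal_adele f) \<le> 1" if y: "y \<noteq> x" for y
  proof (cases "y \<in> S")
    case False
    with y have "adele_abs y a \<le> 1" by (simp add: S_def)
    with f(2)[OF y False] adele_abs_diff[of y a "principal_adele f"] show ?thesis by simp
  qed (use f(1) y in simp)
  obtain g where g: "adele_abs x (a - principal_adele f - principal_adele g) < 1"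
    "\<And>y. y \<noteq> x \<Longrightarrow> place_abs y g \<le> 1" using principal[of x] by blast
  have diff: "a - principal_adele (f + g) = a - principal_adele f + - principal_adele g"
    by (simp add: principal_adele_add)
  show ?thesis
  proof (rule that)
    show "adele_abs y (a - principal_adele (f + g)) \<le> 1" if "y \<noteq> x" for y
      unfolding diff using f'[OF that] g(2)[OF that] by (intro adele_abs_add_le) auto
    show "adele_abs x (a - principal_adele (f + g)) < 1" using g(1) by (simp add: diff)
  qed
qed

text \<open>
  The divisor of \<open>s\<close> outside \<open>x\<close> is finite, and each of its points is the divisor of a rational
  function there.
\<close>

lemma class_number_one:
  assumes deg: "place_degree x = 1" and s: "s * t = 1"
  obtains f where "f \<noteq> 0" "\<And>y. y \<noteq> x \<Longrightarrow> place_abs y f = adele_abs y s"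
proof -
  have one: "\<exists>g. g \<noteq> 0 \<and> (\<forall>z. z \<noteq> x \<longrightarrow> place_abs z g = (if z = y then adele_abs y s else 1))"
    if y: "y \<noteq> x" for y
  proof -
    obtain h where h: "h \<noteq> 0" "place_abs y h = adele_abs y s"
      using ex_place_abs_eq_adele_abs[OF adele_unit_abs(1)[OF s]] by blast
    obtain \<pi> where \<pi>: "\<pi> \<noteq> 0" "\<And>z. z \<noteq> x \<Longrightarrow> place_val z \<pi> = (if z = y then 1 else 0)"
      using ex_uniformizer_unit_elsewhere[OF deg y] by blast
    define g where "g = (if place_val y h \<ge> 0 then \<pi> ^ nat (place_val y h)
      else inverse (\<pi> ^ nat (- place_val y h)))"
    have g0: "g \<noteq> 0" using \<pi>(1) by (simp add: g_def)
    have v: "place_val z g = (if z = y then place_val y h else 0)" if "z \<noteq> x" for z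
      using \<pi>(1) \<pi>(2)[OF that] y by (cases "z = y") (simp_all add: g_def place_val_inverse place_val_power)
    have "place_abs z g = (if z = y then adele_abs y s else 1)" if "z \<noteq> x" for z
      using v[OF that] g0 h by (auto simp: place_abs_eq_1_iff) (auto simp: place_abs_def)
    with g0 show ?thesis by blast
  qed
  define S where "S = {y. adele_abs y s \<noteq> 1} - {x}"
  have "finite S" using adele_unit_abs(3)[OF s] by (simp add: S_def)
  then have "\<exists>f. f \<noteq> 0 \<and> (\<forall>y. y \<noteq> x \<longrightarrow> place_abs y f = (if y \<in> S then adele_abs y s else 1))"
    if "x \<notin> S"
    using that
  proof (induction S rule: finite_induct)
    case empty
    show ?case by (intro exI[of _ 1]) simp
  next
    case (insert z S)
    then obtain f where f: "f \<noteq> 0" "\<And>y. y \<noteq> x \<Longrightarrow> place_abs y f = (if y \<in> S then adele_abs y s else 1)"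
      by auto
    obtain g where g: "g \<noteq> 0" "\<And>y. y \<noteq> x \<Longrightarrow> place_abs y g = (if y = z then adele_abs z s else 1)"
      using one[of z] insert.prems by auto
    show ?case
      using f g insert.hyps(2) by (intro exI[of _ "f * g"]) (auto simp: place_abs_mult)
  qed
  then obtain f where f: "f \<noteq> 0" "\<And>y. y \<noteq> x \<Longrightarrow> place_abs y f = (if y \<in> S then adele_abs y s else 1)"
    by (auto simp: S_def)
  show ?thesis
  proof (rule that[OF f(1)])
    show "place_abs y f = adele_abs y s" if "y \<noteq> x" for y
      using f(2)[OF that] that by (auto simp: S_def)
  qed
qed

section \<open>Two by two matrices\<close>

definition mat2 :: "'r \<Rightarrow> 'r \<Rightarrow> 'r \<Rightarrow> 'r \<Rightarrow> 'r::comm_ring_1 ^ 2 ^ 2" where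
  "mat2 a b c d = vector [vector [a, b], vector [c, d]]"

lemma mat2_nth [simp]:
  "mat2 a b c d $ 1 $ 1 = a" "mat2 a b c d $ 1 $ 2 = b"
  "mat2 a b c d $ 2 $ 1 = c" "mat2 a b c d $ 2 $ 2 = d"
  by (simp_all add: mat2_def)

lemma mat2_eqI:
  fixes A :: "'r::comm_ring_1 ^ 2 ^ 2"
  assumes "A $ 1 $ 1 = B $ 1 $ 1" "A $ 1 $ 2 = B $ 1 $ 2" "A $ 2 $ 1 = B $ 2 $ 1" "A $ 2 $ 2 = B $ 2 $ 2"
  shows "A = B"
  using assms by (simp add: vec_eq_iff forall_2)

lemma mat2_eta: "A = mat2 (A $ 1 $ 1) (A $ 1 $ 2) (A $ 2 $ 1) (A $ 2 $ 2)"
  by (rule mat2_eqI) simp_all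

lemma mat2_mult:
  "mat2 a b c d ** mat2 a' b' c' d' =
    mat2 (a * a' + b * c') (a * b' + b * d') (c * a' + d * c') (c * b' + d * d')"
  by (rule mat2_eqI) (simp_all add: matrix_matrix_mult_def sum_2)

lemma matrix_add_right_distrib:
  fixes A B C :: "'r::comm_ring_1 ^ 2 ^ 2"
  shows "(A + B) ** C = A ** C + B ** C"
  by (rule mat2_eqI) (simp_all add: matrix_matrix_mult_def sum_2 algebra_simps)

lemma mat_eq_mat2: "mat z = mat2 z 0 0 z"
  by (rule mat2_eqI) (simp_all add: mat_def)

lemma det_mat2 [simp]: "det (mat2 a b c d) = a * d - b * c"
  by (simp add: det_2)

lemma mat2_adjugate:
  assumes "det A * u = 1"
  shows "A ** mat2 (u * A $ 2 $ 2) (- (u * A $ 1 $ 2)) (- (u * A $ 2 $ 1)) (u * A $ 1 $ 1) = mat 1"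
    "mat2 (u * A $ 2 $ 2) (- (u * A $ 1 $ 2)) (- (u * A $ 2 $ 1)) (u * A $ 1 $ 1) ** A = mat 1"
proof -
  have "u * (A $ 1 $ 1 * A $ 2 $ 2 - A $ 1 $ 2 * A $ 2 $ 1) = 1"
    using assms by (simp add: det_2 mult.commute)
  then show "A ** mat2 (u * A $ 2 $ 2) (- (u * A $ 1 $ 2)) (- (u * A $ 2 $ 1)) (u * A $ 1 $ 1) = mat 1"
    "mat2 (u * A $ 2 $ 2) (- (u * A $ 1 $ 2)) (- (u * A $ 2 $ 1)) (u * A $ 1 $ 1) ** A = mat 1"
    by (subst mat2_eta[of A]; simp add: mat2_mult mat_eq_mat2;
        intro arg_cong4[where f = mat2]; simp add: algebra_simps)+
qed

lemma GL2_iff: "A \<in> GL2 \<longleftrightarrow> (\<exists>u. det A * u = 1)"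
proof
  assume "A \<in> GL2"
  then obtain B where "A ** B = mat 1" by (auto simp: GL2_def invertible_def)
  then have "det A * det B = 1" by (simp flip: det_mul)
  then show "\<exists>u. det A * u = 1" by blast
next
  assume "\<exists>u. det A * u = 1"
  then show "A \<in> GL2" using mat2_adjugate unfolding GL2_def invertible_def by blast
qed

lemma GL2_mult: "A \<in> GL2 \<Longrightarrow> B \<in> GL2 \<Longrightarrow> A ** B \<in> GL2"
  by (simp add: GL2_def invertible_mult)

lemma unipotent_eq_mat2: "unipotent a = mat2 1 a 0 1"
  by (simp add: unipotent_def mat2_def)

lemma principal_adele_1: "principal_adele 1 = 1"
  by (simp add: principal_adele_def one_adele_def)

lemma principal_matrix_mat2:
  "principal_matrix (mat2 a b c d) =
    mat2 (principal_adele a) (principal_adele b) (principal_adele c) (principal_adele d)"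
  by (rule mat2_eqI) (simp_all add: principal_matrix_def map_matrix_def)

lemma scalar_in_center:
  assumes "t * v = (1 :: 'a::{field, finite} adele)"
  shows "mat2 t 0 0 t \<in> GL2_center"
proof -
  have "det (mat2 t 0 0 t) * (v * v) = (t * v) * (t * v)" by (simp add: algebra_simps)
  then have "det (mat2 t 0 0 t) * (v * v) = 1" using assms by simp
  then have "mat2 t 0 0 t \<in> GL2" using GL2_iff by blast
  moreover have "mat2 t 0 0 t ** g = g ** mat2 t 0 0 t" for g
    by (subst (1 2) mat2_eta[of g]) (simp add: mat2_mult mult.commute)
  ultimately show ?thesis by (simp add: GL2_center_def)
qed

section \<open>Compact subgroups\<close>

definition maximal_compact :: "('a::{field, finite} adele ^ 2 ^ 2) set" where
  "maximal_compact = {k \<in> GL2. \<forall>y. integral_at y k}"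

lemma adele_abs_matrix_mult_le:
  fixes A B :: "'a::{field, finite} adele ^ 2 ^ 2"
  assumes "\<And>i j. adele_abs y (A $ i $ j) \<le> 1" "\<And>i j. adele_abs y (B $ i $ j) \<le> 1"
  shows "adele_abs y ((A ** B) $ i $ j) \<le> 1"
  using assms by (simp add: matrix_matrix_mult_def sum_2)
    (intro adele_abs_add_le; simp add: adele_abs_mult mult_le_one)

lemma mult_less_one_of_le_less:
  fixes a b :: real
  assumes "0 \<le> a" "a \<le> 1" "0 \<le> b" "b < 1"
  shows "a * b < 1" "b * a < 1"
  using assms mult_left_le_one_le[of b a] by (auto simp: mult.commute)

lemma adele_abs_matrix_mult_less:
  fixes A B :: "'a::{field, finite} adele ^ 2 ^ 2"
  assumes "\<And>i j. adele_abs y (A $ i $ j) \<le> 1" "\<And>i j. adele_abs y (B $ i $ j) < 1"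
  shows "adele_abs y ((A ** B) $ i $ j) < 1" "adele_abs y ((B ** A) $ i $ j) < 1"
  using assms by (simp_all add: matrix_matrix_mult_def sum_2)
    (intro adele_abs_add_less; simp add: adele_abs_mult mult_less_one_of_le_less)+

lemma maximal_compact_mult:
  "k \<in> maximal_compact \<Longrightarrow> l \<in> maximal_compact \<Longrightarrow> k ** l \<in> maximal_compact"
  by (auto simp: maximal_compact_def integral_at_def GL2_mult det_mul adele_abs_mult
      intro!: adele_abs_matrix_mult_le)

lemma maximal_compact_mat2I:
  assumes "(a * d - b * c) * u = 1" "\<And>y. adele_abs y (a * d - b * c) = 1"
    "\<And>y. adele_abs y a \<le> 1" "\<And>y. adele_abs y b \<le> 1" "\<And>y. adele_abs y c \<le> 1" "\<And>y. adele_abs y d \<le> 1"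
  shows "mat2 a b c d \<in> maximal_compact"
  using assms by (auto simp: maximal_compact_def integral_at_def GL2_iff forall_2)

text \<open>
  Conjugation by \<open>k\<close> preserves \<open>m - 1 \<equiv> 0\<close> modulo \<open>\<pi>\<^sub>x\<close>, since \<open>k\<close> and its inverse are integral.
\<close>

lemma maximal_compact_normalises_level_subgroup:
  assumes k: "k \<in> maximal_compact" and m: "m \<in> level_subgroup x"
  obtains m' where "m' \<in> level_subgroup x" "m ** k = k ** m'"
proof -
  obtain u where u: "det k * u = 1" using k by (auto simp: maximal_compact_def GL2_iff)
  define l where "l = mat2 (u * k $ 2 $ 2) (- (u * k $ 1 $ 2)) (- (u * k $ 2 $ 1)) (u * k $ 1 $ 1)"
  have kl: "k ** l = mat 1" and lk: "l ** k = mat 1"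
    unfolding l_def by (rule mat2_adjugate[OF u])+
  have ki: "adele_abs y (k $ i $ j) \<le> 1" "adele_abs y (det k) = 1" for y i j
    using k by (auto simp: maximal_compact_def integral_at_def)
  have uy: "adele_abs y u = 1" for y using adele_unit_abs(2)[OF u, of y] ki(2)[of y] by simp
  have li: "adele_abs y (l $ i $ j) \<le> 1" for y i j
    using ki(1)[of y] exhaust_2[of i] exhaust_2[of j]
    by (auto simp: l_def adele_abs_mult uy)
  have l: "l \<in> maximal_compact"
  proof -
    have dl: "det l * det k = 1" using lk by (simp flip: det_mul)
    have "adele_abs y (det l) = 1" for y
      using arg_cong[OF dl, of "adele_abs y"] ki(2)[of y] by (simp add: adele_abs_mult)
    with dl li show ?thesis by (auto simp: maximal_compact_def GL2_iff integral_at_def)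
  qed
  have mK: "m \<in> maximal_compact" using m by (auto simp: level_subgroup_def maximal_compact_def)
  define m' where "m' = l ** m ** k"
  have m'K: "m' \<in> maximal_compact"
    unfolding m'_def by (intro maximal_compact_mult l mK k)
  have "m' = l ** (mat 1 + (m - mat 1)) ** k" by (simp add: m'_def)
  also have "\<dots> = l ** k + l ** (m - mat 1) ** k"
    by (simp only: matrix_add_ldistrib matrix_add_right_distrib matrix_mul_rid)
  also have "\<dots> = mat 1 + l ** (m - mat 1) ** k" by (simp only: lk)
  finally have "m' - mat 1 = l ** (m - mat 1) ** k" by simp
  moreover have "adele_abs x ((l ** (m - mat 1) ** k) $ i $ j) < 1" for i j
    using m by (intro adele_abs_matrix_mult_less ki li) (auto simp: level_subgroup_def congruent_one_at_def)
  ultimately have "congruent_one_at x m'" by (simp only: congruent_one_at_def simp_thms)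
  then have "m' \<in> level_subgroup x"
    using m'K by (simp add: level_subgroup_def maximal_compact_def)
  moreover have "m ** k = k ** m'"
    by (simp add: m'_def matrix_mul_assoc kl)
  ultimately show ?thesis using that by blast
qed

lemma unipotent_in_level_subgroup:
  assumes "\<And>y. y \<noteq> x \<Longrightarrow> adele_abs y b \<le> 1" "adele_abs x b < 1"
  shows "unipotent b \<in> level_subgroup x"
proof -
  have "adele_abs y b \<le> 1" for y using assms by (cases "y = x") auto
  then show ?thesis
    using assms(2) by (auto simp: level_subgroup_def integral_at_def congruent_one_at_def unipotent_eq_mat2
        GL2_iff forall_2 mat_eq_mat2)
qed

section \<open>The Iwasawa decomposition\<close>

text \<open>
  At each place a column operation with integral coefficients clears the smaller entry of the bottom
  row by means of the larger one. That the remaining entry \<open>d\<close> is an idele follows from the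
  determinant: where it is a unit and the entries are integral, \<open>d\<close> must be a unit.
\<close>

lemma iwasawa_decomposition:
  assumes g: "g \<in> GL2"
  obtains t\<^sub>1 t\<^sub>2 v b k where "k \<in> maximal_compact" "g = mat2 t\<^sub>1 b 0 t\<^sub>2 ** k" "t\<^sub>2 * v = 1"
    "\<And>y. adele_abs y t\<^sub>2 = max (adele_abs y (g $ 2 $ 1)) (adele_abs y (g $ 2 $ 2))"
proof -
  define S where "S = {y. adele_abs y (g $ 2 $ 2) < adele_abs y (g $ 2 $ 1)}"
  define e where "e = place_indicator S"
  have ee: "e * e = e" by (simp add: e_def place_indicator_idem)
  \<comment> \<open>\<open>w\<close> swaps the columns at the places where the lower left entry is the larger one.\<close>
  define w where "w = mat2 (1 - e) e e (1 - e)"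
  have sq: "(1 - e) * (1 - e) = 1 - e" "e * (1 - e) = 0" "(1 - e) * e = 0"
    by (simp_all add: algebra_simps ee)
  have ww: "w ** w = mat 1" by (simp add: w_def mat2_mult sq ee mat_eq_mat2)
  have detw: "det w = 1 - e - e" by (simp add: w_def sq ee)
  have detw2: "det w * det w = 1" using ww by (simp flip: det_mul)
  have detw1: "adele_abs y (det w) = 1" for y
  proof -
    have "adele_abs y (det w) * adele_abs y (det w) = 1"
      using arg_cong[OF detw2, of "adele_abs y"] by (simp add: adele_abs_mult)
    then have "(adele_abs y (det w))\<^sup>2 = 1" by (simp add: power2_eq_square)
    then have "adele_abs y (det w) = 1 \<or> adele_abs y (det w) = - 1" by (simp only: power2_eq_1_iff)
    with adele_abs_nonneg[of y "det w"] show ?thesis by linarith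
  qed
  have ele: "adele_abs y e \<le> 1" "adele_abs y (1 - e) \<le> 1" for y
    using adele_abs_glue[of y S 1 0] adele_abs_glue[of y S 0 1] by (simp_all add: e_def split: if_splits)
  have wK: "w \<in> maximal_compact"
    unfolding w_def using detw1 detw2 ele by (intro maximal_compact_mat2I[of _ _ _ _ "det w"]) (simp_all add: w_def)
  define h where "h = g ** w"
  obtain a b c d where h: "h = mat2 a b c d" using mat2_eta by blast
  have hg: "c = e * g $ 2 $ 2 + (1 - e) * g $ 2 $ 1" "d = e * g $ 2 $ 1 + (1 - e) * g $ 2 $ 2"
  proof -
    have "h = mat2 (g$1$1) (g$1$2) (g$2$1) (g$2$2) ** w" unfolding h_def by (subst mat2_eta[of g]) simp
    then have "h $ 2 $ 1 = e * g $ 2 $ 2 + (1 - e) * g $ 2 $ 1" "h $ 2 $ 2 = e * g $ 2 $ 1 + (1 - e) * g $ 2 $ 2"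
      by (simp_all add: w_def mat2_mult algebra_simps)
    then show "c = e * g $ 2 $ 2 + (1 - e) * g $ 2 $ 1" "d = e * g $ 2 $ 1 + (1 - e) * g $ 2 $ 2"
      by (simp_all add: h)
  qed
  have d_abs: "adele_abs y d = max (adele_abs y (g $ 2 $ 1)) (adele_abs y (g $ 2 $ 2))" for y
    unfolding hg(2) e_def adele_abs_glue by (auto simp: S_def)
  have cd: "adele_abs y c \<le> adele_abs y d" for y
    unfolding d_abs unfolding hg(1) e_def adele_abs_glue by auto
  obtain D' where D': "(a * d - b * c) * D' = 1"
  proof -
    have "h \<in> GL2" unfolding h_def using g wK by (intro GL2_mult) (simp_all add: maximal_compact_def)
    with that show ?thesis by (auto simp: GL2_iff h)
  qed
  note D = adele_unit_abs[OF D']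
  have D_le: "adele_abs y (a * d - b * c) \<le> max (adele_abs y a) (adele_abs y b) * adele_abs y d" for y
  proof -
    have "adele_abs y (a * d - b * c) \<le> max (adele_abs y (a * d)) (adele_abs y (b * c))"
      by (rule adele_abs_diff)
    also have "\<dots> \<le> max (adele_abs y a) (adele_abs y b) * adele_abs y d"
      unfolding adele_abs_mult using cd[of y] by (intro max.boundedI mult_mono) (auto simp: le_max_iff_disj)
    finally show ?thesis .
  qed
  have d0: "adele_abs y d \<noteq> 0" for y
    using D_le[of y] D(1)[of y] adele_abs_nonneg[of y "a * d - b * c"] by (metis antisym mult_zero_right)
  have "{y. adele_abs y d \<noteq> 1} \<subseteq> {y. adele_abs y (a * d - b * c) \<noteq> 1} \<union>
      {y. adele_abs y a > 1} \<union> {y. adele_abs y b > 1} \<union> {y. adele_abs y d > 1}"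
  proof (intro subsetI)
    fix y assume y: "y \<in> {y. adele_abs y d \<noteq> 1}"
    have "adele_abs y d \<ge> 1"
      if "adele_abs y (a * d - b * c) = 1" "adele_abs y a \<le> 1" "adele_abs y b \<le> 1"
      using D_le[of y] that mult_right_mono[of "max (adele_abs y a) (adele_abs y b)" 1 "adele_abs y d"] by simp
    with y show "y \<in> {y. adele_abs y (a * d - b * c) \<noteq> 1} \<union>
      {y. adele_abs y a > 1} \<union> {y. adele_abs y b > 1} \<union> {y. adele_abs y d > 1}" by force
  qed
  then have "finite {y. adele_abs y d \<noteq> 1}"
    by (rule finite_subset) (intro finite_UnI finite_adele_poles D(3))
  from adele_unitI[OF d0 this] obtain v where v: "d * v = 1" by blast
  define l where "l = mat2 1 0 (c * v) 1"
  have lK: "l \<in> maximal_compact"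
  proof -
    have "adele_abs y (c * v) \<le> 1" for y
    proof -
      have "adele_abs y d > 0" using d0[of y] adele_abs_nonneg[of y d] by linarith
      with cd[of y] show ?thesis by (simp add: adele_abs_mult adele_unit_abs(2)[OF v] field_simps)
    qed
    then show ?thesis unfolding l_def by (intro maximal_compact_mat2I[of _ _ _ _ 1]) simp_all
  qed
  have "mat2 (a - b * c * v) b 0 d ** l = h"
  proof -
    have "d * (c * v) = c" using v by (simp add: mult.left_commute)
    then show ?thesis by (simp add: l_def h mat2_mult mult.assoc)
  qed
  then have "g = mat2 (a - b * c * v) b 0 d ** (l ** w)"
    using ww by (simp add: matrix_mul_assoc h_def) (simp flip: matrix_mul_assoc)
  then show ?thesis using that lK wK v d_abs maximal_compact_mult by blast
qed

section \<open>Cusp forms\<close>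

lemma automorphic_formD:
  assumes "f \<in> automorphic_forms K'"
  shows "g \<notin> GL2 \<Longrightarrow> f g = 0"
    and "\<gamma> \<in> GL2 \<Longrightarrow> g \<in> GL2 \<Longrightarrow> f (principal_matrix \<gamma> ** g) = f g"
    and "z \<in> GL2_center \<Longrightarrow> g \<in> GL2 \<Longrightarrow> f (z ** g) = f g"
    and "k \<in> K' \<Longrightarrow> g \<in> GL2 \<Longrightarrow> f (g ** k) = f g"
  using assms by (auto simp: automorphic_forms_def)

lemma cusp_form_zero_if_unipotent_invariant:
  assumes haar: "haar_measure \<mu>" and f: "f \<in> cusp_forms \<mu> K'" and g: "g \<in> GL2"
    and inv: "\<And>a. f (unipotent a ** g) = f g"
  shows "f g = 0"
proof -
  interpret finite_measure \<mu> using haar by (simp add: haar_measure_def)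
  have "constant_term \<mu> f g = measure \<mu> (space \<mu>) *\<^sub>R f g"
    by (simp add: constant_term_def inv)
  moreover have "measure \<mu> (space \<mu>) \<noteq> 0"
    using haar by (simp add: haar_measure_def emeasure_eq_measure)
  ultimately show ?thesis using f g by (simp add: cusp_forms_def)
qed

lemma borel_in_GL2:
  assumes "s * t = 1"
  shows "mat2 s a 0 1 \<in> GL2"
  using assms by (auto simp: GL2_iff)

text \<open>
  For these \<open>s\<close> the unipotent translations that come from \<open>K'\<close> and from \<open>F\<close> together exhaust \<open>\<bbbA>\<close>.
\<close>

lemma cusp_form_zero_if_ratio_large:
  assumes haar: "haar_measure \<mu>" and deg: "place_degree x = 1"
    and f: "f \<in> cusp_forms \<mu> (level_subgroup x)"
    and s: "s * t = 1" "\<And>y. y \<noteq> x \<Longrightarrow> adele_abs y s = 1" "adele_abs x s \<ge> 1"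
    and k: "k \<in> maximal_compact"
  shows "f (mat2 s a 0 1 ** k) = 0"
proof (rule cusp_form_zero_if_unipotent_invariant[OF haar f])
  have fA: "f \<in> automorphic_forms (level_subgroup x)" using f by (simp add: cusp_forms_def)
  have kG: "k \<in> GL2" using k by (simp add: maximal_compact_def)
  show gG: "mat2 s a 0 1 ** k \<in> GL2" by (intro GL2_mult borel_in_GL2[OF s(1)] kG)
  fix a'
  obtain \<phi> where \<phi>: "\<And>y. y \<noteq> x \<Longrightarrow> adele_abs y (a' - principal_adele \<phi>) \<le> 1"
    "adele_abs x (a' - principal_adele \<phi>) < 1" using strong_approximation[OF deg] by blast
  define b where "b = (a' - principal_adele \<phi>) * t"
  have tb: "adele_abs y t = inverse (adele_abs y s)" for y by (rule adele_unit_abs(2)[OF s(1)])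
  have "unipotent b \<in> level_subgroup x"
  proof (rule unipotent_in_level_subgroup)
    show "adele_abs y b \<le> 1" if "y \<noteq> x" for y
      using \<phi>(1)[OF that] s(2)[OF that] by (simp add: b_def adele_abs_mult tb)
    have "inverse (adele_abs x s) \<le> 1" using s(3) by (simp add: inverse_le_1_iff)
    with \<phi>(2) s(3) show "adele_abs x b < 1"
      by (simp add: b_def adele_abs_mult tb mult.commute mult_less_one_of_le_less)
  qed
  from maximal_compact_normalises_level_subgroup[OF k this]
  obtain m where m: "m \<in> level_subgroup x" "unipotent b ** k = k ** m" .
  have "s * b = (a' - principal_adele \<phi>) * (s * t)" by (simp only: b_def mult.left_commute)
  then have "s * b = a' - principal_adele \<phi>" by (simp add: s(1))
  then have "unipotent a' ** mat2 s a 0 1 = principal_matrix (mat2 1 \<phi> 0 1) ** (mat2 s a 0 1 ** unipotent b)"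
    by (simp add: unipotent_eq_mat2 principal_matrix_mat2 mat2_mult principal_adele_0 principal_adele_1 add.commute)
  then have "unipotent a' ** (mat2 s a 0 1 ** k)
      = principal_matrix (mat2 1 \<phi> 0 1) ** (mat2 s a 0 1 ** (unipotent b ** k))"
    by (simp add: matrix_mul_assoc)
  also have "\<dots> = principal_matrix (mat2 1 \<phi> 0 1) ** ((mat2 s a 0 1 ** k) ** m)"
    by (simp add: m(2) matrix_mul_assoc)
  also have "f \<dots> = f ((mat2 s a 0 1 ** k) ** m)"
    using m(1) by (intro automorphic_formD(2)[OF fA] GL2_mult[OF gG]) (auto simp: GL2_iff level_subgroup_def)
  also have "\<dots> = f (mat2 s a 0 1 ** k)" using m(1) gG by (rule automorphic_formD(4)[OF fA])
  finally show "f (unipotent a' ** (mat2 s a 0 1 ** k)) = f (mat2 s a 0 1 ** k)" .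
qed

text \<open>
  The form is invariant under \<open>K'\<close> but not under \<open>K\<close>, so a further factor \<open>l\<close> of \<open>K\<close> on the right has
  to be carried along.
\<close>

lemma automorphic_form_iwasawa:
  fixes g :: "'a::{field, finite} adele ^ 2 ^ 2"
  assumes f: "f \<in> automorphic_forms K'" and g: "g \<in> GL2"
  obtains s t a k where "s * t = 1" "k \<in> maximal_compact"
    "\<And>l. l \<in> maximal_compact \<Longrightarrow> f (g ** l) = f (mat2 s a 0 1 ** (k ** l))"
    "\<And>y. adele_abs y s = adele_abs y (det g) / (max (adele_abs y (g $ 2 $ 1)) (adele_abs y (g $ 2 $ 2)))\<^sup>2"
proof -
  obtain t\<^sub>1 t\<^sub>2 v b k where k: "k \<in> maximal_compact" and gk: "g = mat2 t\<^sub>1 b 0 t\<^sub>2 ** k" and v: "t\<^sub>2 * v = 1"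
    and t2: "\<And>y. adele_abs y t\<^sub>2 = max (adele_abs y (g $ 2 $ 1)) (adele_abs y (g $ 2 $ 2))"
    by (rule iwasawa_decomposition[OF g that])
  obtain u where u: "det g * u = 1" using g by (auto simp: GL2_iff)
  have det: "det g = t\<^sub>1 * t\<^sub>2 * det k" by (simp add: gk det_mul)
  define s where "s = t\<^sub>1 * v"
  have "s * (t\<^sub>2 * t\<^sub>2 * det k * u) = (t\<^sub>2 * v) * (det g * u)" by (simp add: s_def det algebra_simps)
  with u v have s: "s * (t\<^sub>2 * t\<^sub>2 * det k * u) = 1" by simp
  have "mat2 t\<^sub>1 b 0 t\<^sub>2 = mat2 t\<^sub>2 0 0 t\<^sub>2 ** mat2 s (b * v) 0 1"
    using v by (simp add: mat2_mult s_def mult.left_commute)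
  then have gl: "g ** l = mat2 t\<^sub>2 0 0 t\<^sub>2 ** (mat2 s (b * v) 0 1 ** (k ** l))" for l :: "'a adele ^ 2 ^ 2"
    by (simp add: gk matrix_mul_assoc)
  have "f (g ** l) = f (mat2 s (b * v) 0 1 ** (k ** l))" if l: "l \<in> maximal_compact" for l
    unfolding gl using k l
    by (intro automorphic_formD(3)[OF f scalar_in_center[OF v]] GL2_mult borel_in_GL2[OF s])
      (simp_all add: maximal_compact_def)
  moreover have "adele_abs y s = adele_abs y (det g) / (max (adele_abs y (g $ 2 $ 1)) (adele_abs y (g $ 2 $ 2)))\<^sup>2" for y
  proof -
    have "adele_abs y (det k) = 1" using k by (simp add: maximal_compact_def integral_at_def)
    then show ?thesis
      using adele_unit_abs(1)[OF v, of y]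
      by (simp add: det s_def adele_abs_mult adele_unit_abs(2)[OF v] power2_eq_square field_simps flip: t2)
  qed
  ultimately show ?thesis using that s k by blast
qed

lemma adele_abs_discrete:
  assumes "adele_abs y a < 1"
  shows "adele_abs y a \<le> inverse (real CARD('a) ^ place_degree (y :: 'a::{field, finite} place))"
proof (cases "adele_abs y a = 0")
  case False
  obtain f where f: "f \<noteq> 0" "place_abs y f = adele_abs y a"
    using ex_place_abs_eq_adele_abs[OF False] by blast
  have "place_val y f \<ge> 1"
    using assms f place_abs_less_1_iff[of y f] by (simp add: val_ge_def)
  then have "place_abs y f \<le> (real CARD('a) ^ place_degree y) powr (- 1)"
    unfolding place_abs_eq_powr[OF f(1)] using card_power_degree_gt_1[of y] by (intro powr_mono) auto
  then show ?thesis using f card_power_degree_gt_1[of y] by (simp add: powr_minus)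
qed simp

text \<open>
  Reduction theory: each step of the descent multiplies \<open>\<bar>s\<bar>\<^sub>x\<close> by at least \<open>\<bar>\<pi>\<^sub>x\<bar>\<^sub>x\<^sup>-\<^sup>2\<close>, unless
  already \<open>\<bar>s\<bar>\<^sub>x \<ge> 1\<close>.
\<close>

lemma cusp_form_zero_on_borel:
  assumes haar: "haar_measure \<mu>" and deg: "place_degree x = 1"
    and f: "f \<in> cusp_forms \<mu> (level_subgroup x)"
    and "s * t = 1" "\<And>y. y \<noteq> x \<Longrightarrow> adele_abs y s = 1"
    and "k \<in> maximal_compact"
  shows "f (mat2 s a 0 1 ** k) = 0"
proof -
  have fA: "f \<in> automorphic_forms (level_subgroup x)" using f by (simp add: cusp_forms_def)
  define r where "r = inverse (real CARD('a) ^ place_degree x)"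
  have r: "0 < r" "r < 1"
    using card_power_degree_gt_1[of x] by (auto simp: r_def inverse_less_1_iff)
  have "f (mat2 s a 0 1 ** k) = 0"
    if "r ^ n \<le> adele_abs x s" "s * t = 1" "\<And>y. y \<noteq> x \<Longrightarrow> adele_abs y s = 1" "k \<in> maximal_compact"
    for n s t a k
    using that
  proof (induction n arbitrary: s t a k)
    case 0
    then show ?case by (intro cusp_form_zero_if_ratio_large[OF haar deg f]) auto
  next
    case (Suc n)
    show ?case
    proof (cases "adele_abs x s \<ge> 1")
      case True
      with Suc.prems show ?thesis by (intro cusp_form_zero_if_ratio_large[OF haar deg f]) auto
    next
      case False
      have kG: "k \<in> GL2" using Suc.prems by (simp add: maximal_compact_def)
      obtain \<phi> where \<phi>: "\<And>y. y \<noteq> x \<Longrightarrow> adele_abs y (a - principal_adele \<phi>) \<le> 1"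
        "adele_abs x (a - principal_adele \<phi>) < 1" using strong_approximation[OF deg] by blast
      define b where "b = a - principal_adele \<phi>"
      \<comment> \<open>Translate by \<open>- \<phi>\<close> and apply the Weyl element.\<close>
      have "principal_matrix (mat2 0 1 1 (- \<phi>)) ** mat2 s a 0 1 = mat2 0 1 s b"
        by (simp add: principal_matrix_mat2 mat2_mult principal_adele_0 principal_adele_1
          principal_adele_minus b_def)
      then have eq: "principal_matrix (mat2 0 1 1 (- \<phi>)) ** (mat2 s a 0 1 ** k) = mat2 0 1 s b ** k"
        by (simp add: matrix_mul_assoc)
      have "mat2 0 1 1 (- \<phi>) \<in> GL2" by (auto simp: GL2_iff intro: exI[of _ "- 1"])
      then have f1: "f (mat2 0 1 s b ** k) = f (mat2 s a 0 1 ** k)"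
        using automorphic_formD(2)[OF fA, of "mat2 0 1 1 (- \<phi>)" "mat2 s a 0 1 ** k"]
          borel_in_GL2[OF Suc.prems(2)] kG by (simp add: eq GL2_mult)
      have "mat2 0 1 s b \<in> GL2" using Suc.prems(2) by (auto simp: GL2_iff intro: exI[of _ "- t"])
      from automorphic_form_iwasawa[OF fA this]
      obtain s' t' a' k' where s': "s' * t' = 1" and k': "k' \<in> maximal_compact"
        and f2: "\<And>l. l \<in> maximal_compact \<Longrightarrow> f (mat2 0 1 s b ** l) = f (mat2 s' a' 0 1 ** (k' ** l))"
        and s'_abs: "\<And>y. adele_abs y s' = adele_abs y s / (max (adele_abs y s) (adele_abs y b))\<^sup>2"
        by simp metis
      define M where "M = max (adele_abs x s) (adele_abs x b)"
      have s0: "adele_abs x s > 0"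
        using adele_unit_abs(1)[OF Suc.prems(2), of x] adele_abs_nonneg[of x s] by linarith
      have M: "0 < M" "M \<le> r"
        using s0 False \<phi>(2) adele_abs_discrete[of x s] adele_abs_discrete[of x b]
        by (auto simp: M_def r_def b_def)
      have "r ^ n \<le> adele_abs x s'"
      proof -
        have "M\<^sup>2 \<le> r * 1" unfolding power2_eq_square using M r by (intro mult_mono) auto
        then have "r ^ n * M\<^sup>2 \<le> r ^ n * r" using r by (intro mult_left_mono) auto
        also have "\<dots> \<le> adele_abs x s" using Suc.prems(1) by (simp add: mult.commute)
        finally show ?thesis using M by (simp add: s'_abs M_def[symmetric] pos_le_divide_eq)
      qed
      moreover have "adele_abs y s' = 1" if "y \<noteq> x" for y
        using Suc.prems(3)[OF that] \<phi>(1)[OF that] by (simp add: s'_abs b_def max_def)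
      ultimately have "f (mat2 s' a' 0 1 ** (k' ** k)) = 0"
        using s' maximal_compact_mult[OF k' Suc.prems(4)] by (intro Suc.IH) auto
      with f1 f2[OF Suc.prems(4)] show ?thesis by simp
    qed
  qed
  moreover obtain n where "r ^ n < adele_abs x s"
  proof -
    have "adele_abs x s > 0"
      using adele_unit_abs(1)[OF assms(4), of x] adele_abs_nonneg[of x s] by linarith
    with real_arch_pow_inv[OF _ r(2)] that show ?thesis by blast
  qed
  ultimately show ?thesis using assms(4-6) less_imp_le by metis
qed

lemma principal_adele_mult: "principal_adele (f * g) = principal_adele f * principal_adele g"
  unfolding principal_adele_def by (simp add: times_adele.abs_eq adele_rel_refl adele_family_const)

lemma cusp_form_zero:
  assumes haar: "haar_measure \<mu>" and deg: "place_degree x = 1"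
    and f: "f \<in> cusp_forms \<mu> (level_subgroup x)"
  shows "f g = 0"
proof (cases "g \<in> GL2")
  case True
  have fA: "f \<in> automorphic_forms (level_subgroup x)" using f by (simp add: cusp_forms_def)
  obtain s t a k where s: "s * t = 1" and k: "k \<in> maximal_compact"
    and fg: "\<And>l. l \<in> maximal_compact \<Longrightarrow> f (g ** l) = f (mat2 s a 0 1 ** (k ** l))"
    using automorphic_form_iwasawa[OF fA True] by metis
  have "mat 1 \<in> (maximal_compact :: ('a adele ^ 2 ^ 2) set)"
    unfolding mat_eq_mat2 by (rule maximal_compact_mat2I[of _ _ _ _ 1]) simp_all
  from fg[OF this] have fg: "f g = f (mat2 s a 0 1 ** k)" by simp
  have kG: "k \<in> GL2" using k by (simp add: maximal_compact_def)
  obtain \<phi> where \<phi>: "\<phi> \<noteq> 0" "\<And>y. y \<noteq> x \<Longrightarrow> place_abs y \<phi> = adele_abs y s"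
    using class_number_one[OF deg s] by blast
  define \<gamma> where "\<gamma> = mat2 (inverse \<phi>) 0 0 1"
  define s' where "s' = principal_adele (inverse \<phi>) * s"
  have inv: "principal_adele (inverse \<phi>) * principal_adele \<phi> = 1"
    using \<phi>(1) by (simp add: principal_adele_1 flip: principal_adele_mult)
  have "s' * (principal_adele \<phi> * t) = (principal_adele (inverse \<phi>) * principal_adele \<phi>) * (s * t)"
    by (simp add: s'_def algebra_simps)
  then have s': "s' * (principal_adele \<phi> * t) = 1" by (simp add: inv s)
  have s'_abs: "adele_abs y s' = 1" if "y \<noteq> x" for y
    using \<phi>(2)[OF that] adele_unit_abs(1)[OF s, of y] by (simp add: s'_def adele_abs_mult place_abs_inverse)
  have "\<gamma> \<in> GL2" using \<phi>(1) by (auto simp: \<gamma>_def GL2_iff intro: exI[of _ \<phi>])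
  then have "f (mat2 s a 0 1 ** k) = f (principal_matrix \<gamma> ** (mat2 s a 0 1 ** k))"
    by (intro automorphic_formD(2)[OF fA, symmetric] GL2_mult borel_in_GL2[OF s] kG)
  also have "principal_matrix \<gamma> ** (mat2 s a 0 1 ** k) = mat2 s' (principal_adele (inverse \<phi>) * a) 0 1 ** k"
    by (simp add: \<gamma>_def principal_matrix_mat2 principal_adele_0 principal_adele_1 matrix_mul_assoc mat2_mult s'_def)
  also have "f \<dots> = 0" by (rule cusp_form_zero_on_borel[OF haar deg f s' s'_abs k])
  finally show ?thesis by (simp add: fg)
next
  case False
  have "f \<in> automorphic_forms (level_subgroup x)" using f by (simp add: cusp_forms_def)
  from automorphic_formD(1)[OF this False] show ?thesis .
qed

lemma zero_is_cusp_form: "(\<lambda>_. 0) \<in> cusp_forms \<mu> K'"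
  by (auto simp: cusp_forms_def automorphic_forms_def moderate_growth_def constant_term_def
      intro!: exI[of _ 0])

theorem theorem4:
  fixes x :: "'a::{field, finite} place"
    and \<mu> :: "'a adele_class measure"
  assumes "haar_measure \<mu>"
    and "place_degree x = 1"
  shows "cusp_forms \<mu> (level_subgroup x) = {\<lambda>_. 0}"
  using cusp_form_zero[OF assms] zero_is_cusp_form by blast

end
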